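(* Let $\mathcal{A}\subset\mathbb{R}^n$ be compact and let $\mathcal{H}_d=(C,f,D,g)$ be a hybrid system whose input affects only the jumps, i.e. $\dot x=f(x)$, $x\in C$; $x^+=g(x,u_d)$, $(x,u_d)\in D$, satisfying the hybrid basic conditions. Suppose there exists a control Lyapunov function $V$ with $\mathcal{U}$ controls for $\mathcal{H}_d$ (with respect to $\mathcal{A}$). Suppose furthermore that: (M1d) the set-valued map $\Psi_d$ is lower semicontinuous with convex values; (M2d) for every $r>0$ and every $x\in\Pi(D)\cap\mathcal{I}(r)$, the function $u_d\mapsto\Gamma_d(x,u_d,r)$ is convex on $\Psi_d(x)$. Then for every $r>0$ there exists a state-feedback law $\rho'_d:\Pi(D)\to\mathcal{U}_d$, given on $R_d\cap\mathcal{I}(r)$ by $$\rho'_d(x):=\arg\min\{|u_d| : u_d\in\mathcal{T}_d(x)\}\quad\forall x\in R_d\cap\mathcal{I}(r),$$ that renders the compact set $\mathcal{A}_r:=\{x\in\mathbb{R}^n:V(x)\le r\}$ asymptotically stable for $\mathcal{H}_d$. Moreover, if $\Psi_d$ has a closed graph then $\rho'_d$ is continuous on $\Pi(D)\cap\mathcal{I}(r)$. Furthermore, if the zero feedback law $\rho_{d,0}:\mathbb{R}^n\to\{0\}\subset\mathcal{U}_d$ is such that (M4) every maximal solution $j\mapsto\phi(0,j)$ to $x^+=g(x,\rho_{d,0}(x))$, $x\in\Pi(D)\cap\mathcal{A}$, satisfies $|\phi(0,j)|_{\mathcal{A}}=0$ for all $(0,j)\in\mathrm{dom}\,\phi$,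 and if (M6) the set-valued map $\mathcal{T}'_d$ (built with this $\rho_{d,0}$) is lower semicontinuous at each $x\in\Pi(D)\cap\mathcal{I}(0)$, then the feedback law $$\rho_d(x):=\arg\min\{|u_d| : u_d\in\mathcal{T}'_d(x)\}\quad\forall x\in\Pi(D)$$ is globally asymptotically stabilizing, i.e. it renders $\mathcal{A}$ globally asymptotically stable for $\mathcal{H}_d$. Furthermore, if $\Psi_d$ has closed graph then $\rho_d$ is continuous.
   Context: Hybrid system. Let $\mathcal{U}=\mathcal{U}_d\subset\mathbb{R}^{m_d}$, $C\subset\mathbb{R}^n$, $D\subset\mathbb{R}^n\times\mathcal{U}_d$, $f:\mathbb{R}^n\to\mathbb{R}^n$, $g:\mathbb{R}^n\times\mathbb{R}^{m_d}\to\mathbb{R}^n$. The system $\mathcal{H}_d=(C,f,D,g)$ satisfies the hybrid basic conditions if $C$ is a closed subset of $\mathbb{R}^n$, $D$ is a closed subset of $\mathbb{R}^n\times\mathcal{U}_d$, and $f$ and $g$ are continuous. Projections. $\Pi(D)=\{x:\exists u_d\in\mathcal{U}_d,\ (x,u_d)\in D\}$; $\Psi_d(x)=\{u_d:(x,u_d)\in D\}$ for $x\in\mathbb{R}^n$. A set-valued map $S:\mathbb{R}^n\rightrightarrows\mathbb{R}^m$ is lower semicontinuous at $x$ if $\liminf_{x_i\to x}S(x_i)\supset S(x)$, where $\liminf_{x_i\to x}S(x_i)=\{z:\forall x_i\to x,\ \exists z_i\to z\text{ s.t. }z_i\in S(x_i)\}$; it is lower semicontinuous if this holds at each $x\in\mathbb{R}^n$.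 Control Lyapunov function (CLF). $|\cdot|$ is the Euclidean norm and $|x|_{\mathcal{A}}=\inf_{y\in\mathcal{A}}|x-y|$. Class $\mathcal{K}_\infty$: functions $[0,\infty)\to[0,\infty)$ that are continuous, zero at zero, strictly increasing and unbounded. A continuous function $V:\mathbb{R}^n\to\mathbb{R}$, continuously differentiable on an open set containing $\overline{C}$, is a CLF with $\mathcal{U}$ controls for $\mathcal{H}_d$ if there exist $\alpha_1,\alpha_2\in\mathcal{K}_\infty$ and a positive definite function $\alpha_3$ such that - $\alpha_1(|x|_{\mathcal{A}})\le V(x)\le\alpha_2(|x|_{\mathcal{A}})$ for all $x\in C\cup\Pi(D)\cup g(D)$; - $\langle\nabla V(x),f(x)\rangle\le-\alpha_3(|x|_{\mathcal{A}})$ for all $x\in C$; - $\inf_{u_d\in\Psi_d(x)}V(g(x,u_d))-V(x)\le-\alpha_3(|x|_{\mathcal{A}})$ for all $x\in\Pi(D)$. Derived objects (for the given $V$, $\alpha_3$). For $r\ge0$, $\mathcal{I}(r)=\{x\in\mathbb{R}^n:V(x)\ge r\}$. $\Gamma_d(x,u_d,r)=V(g(x,u_d))-V(x)+\alpha_3(|x|_{\mathcal{A}})$ if $(x,u_d)\in D\cap(\mathcal{I}(r)\times\mathbb{R}^{m_d})$, and $-\infty$ otherwise. $\mathcal{T}_d(x)=\Psi_d(x)\cap\{u_d\in\mathcal{U}_d:\Gamma_d(x,u_d,V(x))\le0\}$; $R_d=\Pi(D)\cap\{x:V(x)>0\}$. $S^\circ_d(x,r)=\{u_d\in\mathcal{U}_d:\Gamma_d(x,u_d,r)\le0\}$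 if $x\in\Pi(D)\cap\mathcal{I}(r)$, and $S^\circ_d(x,r)=\mathbb{R}^{m_d}$ otherwise. Given $\rho_{d,0}$, $S'_d(x,r)=S^\circ_d(x,r)$ if $r>0$ and $S'_d(x,r)=\{\rho_{d,0}(x)\}$ if $r=0$; $\mathcal{T}'_d(x)=\Psi_d(x)\cap S'_d(x,V(x))$. Closed loop. Applying a feedback $\rho_d$ to $\mathcal{H}_d$ gives $\dot x=f(x)$ for $x\in C$ and $x^+=g(x,\rho_d(x))$ for $x\in\{x:(x,\rho_d(x))\in D\}$ ($x$ ranging over the domain of $\rho_d$). Solutions. A hybrid time domain is a set $E\subset[0,\infty)\times\mathbb{N}$ such that for each $(T,J)\in E$, $E\cap([0,T]\times\{0,\dots,J\})=\bigcup_{j}([t_j,t_{j+1}],j)$ for a finite sequence $0=t_0\le t_1\le\cdots$. Solutions of the closed loop are functions $\phi$ on hybrid time domains, with $t\mapsto\phi(t,j)$ absolutely continuous on $\{t:(t,j)\in\mathrm{dom}\,\phi\}$ for each $j$, satisfying the flow dynamics along each such interval and the jump dynamics at each jump. A solution is complete if its domain is unbounded and maximal if it is not a truncation of another solution to a proper subset of the latter's domain. Asymptotic stability. A compact set $K$ is asymptotically stable for a closed-loop system if: for each $\varepsilon>0$ there exists $\delta>0$ such that each maximal solution $\phi$ starting from $K+\delta\mathbb{B}$ satisfies $\phi(t,j)\in K+\varepsilon\mathbb{B}$ for each $(t,j)\in\mathrm{dom}\,\phi$; and each maximal solution is bounded and the complete ones satisfy $\lim_{t+j\to\infty}|\phi(t,j)|_K=0$.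 Here $\mathbb{B}$ is the closed unit ball. The second property is required of all maximal solutions from every initial condition, so "globally asymptotically stable" refers to the same two properties.
   Formalization: The rate α₃ is taken continuous, with strict jump inequality on Π(D)\A (such α₃ is shown to exist; tight α₃ can make T_d empty); A nonempty, D closed in the ambient space; A_r is assumed compact; (x,0)∈D is assumed for x∈Π(D)∩A, else T'_d(x) is empty. *)

theory Defs
  imports "HOL-Analysis.Analysis"
begin

section \<open>Set-valued maps and comparison functions\<close>

text \<open>
  Lower semicontinuity in the sense of Rockafellar and Wets: the inner limit ranges over all
  sequences in the whole space, and the selection \<open>z i \<in> S (x i)\<close> is required from some index on.
\<close>

definition lsc_at :: "('a::topological_space \<Rightarrow> 'b::topological_space set) \<Rightarrow> 'a \<Rightarrow> bool" where
  "lsc_at S x \<longleftrightarrow>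
     S x \<subseteq> {z. \<forall>\<xi>. \<xi> \<longlonglongrightarrow> x \<longrightarrow> (\<exists>\<zeta>. \<zeta> \<longlonglongrightarrow> z \<and> (\<forall>\<^sub>F i in sequentially. \<zeta> i \<in> S (\<xi> i)))}"

definition lsc :: "('a::topological_space \<Rightarrow> 'b::topological_space set) \<Rightarrow> bool" where
  "lsc S \<longleftrightarrow> (\<forall>x. lsc_at S x)"

definition set_graph :: "('a \<Rightarrow> 'b set) \<Rightarrow> ('a \<times> 'b) set" where
  "set_graph S = {(x, u). u \<in> S x}"

definition argmin_norm :: "'b::real_normed_vector set \<Rightarrow> 'b set" where
  "argmin_norm T = {u. is_arg_min norm (\<lambda>v. v \<in> T) u}"

definition ereal_convex_on :: "'b::real_vector set \<Rightarrow> ('b \<Rightarrow> ereal) \<Rightarrow> bool" where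
  "ereal_convex_on S F \<longleftrightarrow> convex S \<and>
     (\<forall>u\<in>S. \<forall>v\<in>S. \<forall>t\<in>{0..1}.
        F ((1 - t) *\<^sub>R u + t *\<^sub>R v) \<le> ereal (1 - t) * F u + ereal t * F v)"

definition class_K_infinity :: "(real \<Rightarrow> real) \<Rightarrow> bool" where
  "class_K_infinity \<alpha> \<longleftrightarrow> continuous_on {0..} \<alpha> \<and> \<alpha> 0 = 0 \<and> strict_mono_on {0..} \<alpha> \<and>
     (\<forall>M. \<exists>s\<ge>0. \<alpha> s > M)"

text \<open>Positive definite comparison functions are continuous, as usual in Lyapunov theory.\<close>

definition positive_definite_fun :: "(real \<Rightarrow> real) \<Rightarrow> bool" where
  "positive_definite_fun \<alpha> \<longleftrightarrow> continuous_on {0..} \<alpha> \<and> \<alpha> 0 = 0 \<and> (\<forall>s>0. \<alpha> s > 0)"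


section \<open>Hybrid systems with inputs affecting only the jumps\<close>

definition hybrid_basic_conditions ::
  "'b::euclidean_space set \<Rightarrow> 'a::euclidean_space set \<Rightarrow> ('a \<Rightarrow> 'a) \<Rightarrow> ('a \<times> 'b) set \<Rightarrow>
   ('a \<times> 'b \<Rightarrow> 'a) \<Rightarrow> bool" where
  "hybrid_basic_conditions U C f D g \<longleftrightarrow>
     closed C \<and> closed D \<and> D \<subseteq> UNIV \<times> U \<and> continuous_on UNIV f \<and> continuous_on UNIV g"

definition jump_proj :: "'b set \<Rightarrow> ('a \<times> 'b) set \<Rightarrow> 'a set" where
  "jump_proj U D = {x. \<exists>u\<in>U. (x, u) \<in> D}"

definition Psi_d :: "('a \<times> 'b) set \<Rightarrow> 'a \<Rightarrow> 'b set" where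
  "Psi_d D x = {u. (x, u) \<in> D}"


section \<open>Control Lyapunov functions\<close>

definition clf_with ::
  "'b::euclidean_space set \<Rightarrow> 'a::euclidean_space set \<Rightarrow> 'a set \<Rightarrow> ('a \<Rightarrow> 'a) \<Rightarrow> ('a \<times> 'b) set \<Rightarrow>
   ('a \<times> 'b \<Rightarrow> 'a) \<Rightarrow> ('a \<Rightarrow> real) \<Rightarrow> (real \<Rightarrow> real) \<Rightarrow> (real \<Rightarrow> real) \<Rightarrow> (real \<Rightarrow> real) \<Rightarrow> bool" where
  "clf_with U A C f D g V \<alpha>1 \<alpha>2 \<alpha>3 \<longleftrightarrow>
     class_K_infinity \<alpha>1 \<and> class_K_infinity \<alpha>2 \<and> positive_definite_fun \<alpha>3 \<and>
     continuous_on UNIV V \<and>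
     (\<forall>x \<in> C \<union> jump_proj U D \<union> g ` D. \<alpha>1 (infdist x A) \<le> V x \<and> V x \<le> \<alpha>2 (infdist x A)) \<and>
     (\<exists>W dV. open W \<and> closure C \<subseteq> W \<and> (\<forall>x\<in>W. GDERIV V x :> dV x) \<and> continuous_on W dV \<and>
        (\<forall>x\<in>C. dV x \<bullet> f x \<le> - \<alpha>3 (infdist x A))) \<and>
     (\<forall>x \<in> jump_proj U D. (INF u\<in>Psi_d D x. V (g (x, u))) - V x \<le> - \<alpha>3 (infdist x A))"

definition control_lyapunov_function ::
  "'b::euclidean_space set \<Rightarrow> 'a::euclidean_space set \<Rightarrow> 'a set \<Rightarrow> ('a \<Rightarrow> 'a) \<Rightarrow> ('a \<times> 'b) set \<Rightarrow>
   ('a \<times> 'b \<Rightarrow> 'a) \<Rightarrow> ('a \<Rightarrow> real) \<Rightarrow> bool" where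
  "control_lyapunov_function U A C f D g V \<longleftrightarrow> (\<exists>\<alpha>1 \<alpha>2 \<alpha>3. clf_with U A C f D g V \<alpha>1 \<alpha>2 \<alpha>3)"

text \<open>
  The function \<open>\<alpha>3\<close> is not determined by \<open>V\<close>.  The sets \<open>T_d\<close> below may be empty, or fail to be
  lower semicontinuous, when the jump inequality for \<open>\<alpha>3\<close> holds with equality (the infimum need
  not be attained), so they are only used for those \<open>\<alpha>3\<close> for which it is strict outside \<open>A\<close>.
  Every control Lyapunov function has such an \<open>\<alpha>3\<close>: halve any given one.
\<close>

definition strict_clf_rate ::
  "'b::euclidean_space set \<Rightarrow> 'a::euclidean_space set \<Rightarrow> 'a set \<Rightarrow> ('a \<Rightarrow> 'a) \<Rightarrow> ('a \<times> 'b) set \<Rightarrow>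
   ('a \<times> 'b \<Rightarrow> 'a) \<Rightarrow> ('a \<Rightarrow> real) \<Rightarrow> (real \<Rightarrow> real) \<Rightarrow> bool" where
  "strict_clf_rate U A C f D g V \<alpha>3 \<longleftrightarrow>
     (\<exists>\<alpha>1 \<alpha>2. clf_with U A C f D g V \<alpha>1 \<alpha>2 \<alpha>3) \<and>
     (\<forall>x \<in> jump_proj U D - A.
        (INF u\<in>Psi_d D x. V (g (x, u))) - V x < - \<alpha>3 (infdist x A))"

definition superlevel :: "('a \<Rightarrow> real) \<Rightarrow> real \<Rightarrow> 'a set" where
  "superlevel V r = {x. V x \<ge> r}"

definition Gamma_d ::
  "'a::metric_space set \<Rightarrow> ('a \<times> 'b) set \<Rightarrow> ('a \<times> 'b \<Rightarrow> 'a) \<Rightarrow> ('a \<Rightarrow> real) \<Rightarrow> (real \<Rightarrow> real) \<Rightarrow>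
   'a \<Rightarrow> 'b \<Rightarrow> real \<Rightarrow> ereal" where
  "Gamma_d A D g V \<alpha>3 x u r =
     (if (x, u) \<in> D \<inter> (superlevel V r \<times> UNIV)
      then ereal (V (g (x, u)) - V x + \<alpha>3 (infdist x A)) else - \<infinity>)"

definition T_d ::
  "'b set \<Rightarrow> 'a::metric_space set \<Rightarrow> ('a \<times> 'b) set \<Rightarrow> ('a \<times> 'b \<Rightarrow> 'a) \<Rightarrow> ('a \<Rightarrow> real) \<Rightarrow>
   (real \<Rightarrow> real) \<Rightarrow> 'a \<Rightarrow> 'b set" where
  "T_d U A D g V \<alpha>3 x = Psi_d D x \<inter> {u \<in> U. Gamma_d A D g V \<alpha>3 x u (V x) \<le> 0}"

definition R_d :: "'b set \<Rightarrow> ('a \<times> 'b) set \<Rightarrow> ('a \<Rightarrow> real) \<Rightarrow> 'a set" where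
  "R_d U D V = jump_proj U D \<inter> {x. V x > 0}"

definition S_circ_d ::
  "'b set \<Rightarrow> 'a::metric_space set \<Rightarrow> ('a \<times> 'b) set \<Rightarrow> ('a \<times> 'b \<Rightarrow> 'a) \<Rightarrow> ('a \<Rightarrow> real) \<Rightarrow>
   (real \<Rightarrow> real) \<Rightarrow> 'a \<Rightarrow> real \<Rightarrow> 'b set" where
  "S_circ_d U A D g V \<alpha>3 x r =
     (if x \<in> jump_proj U D \<inter> superlevel V r then {u \<in> U. Gamma_d A D g V \<alpha>3 x u r \<le> 0} else UNIV)"

text \<open>
  \<open>S'\<close> is only meaningful for \<open>r \<ge> 0\<close>.  The value chosen for \<open>r < 0\<close> does not affect \<open>T'\<close>, because
  \<open>V \<ge> 0\<close> on the projection of \<open>D\<close> and \<open>Psi_d D x = {}\<close> elsewhere.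
\<close>

definition S_prime_d ::
  "'b set \<Rightarrow> 'a::metric_space set \<Rightarrow> ('a \<times> 'b) set \<Rightarrow> ('a \<times> 'b \<Rightarrow> 'a) \<Rightarrow> ('a \<Rightarrow> real) \<Rightarrow>
   (real \<Rightarrow> real) \<Rightarrow> ('a \<Rightarrow> 'b) \<Rightarrow> 'a \<Rightarrow> real \<Rightarrow> 'b set" where
  "S_prime_d U A D g V \<alpha>3 \<rho>0 x r =
     (if r > 0 then S_circ_d U A D g V \<alpha>3 x r else {\<rho>0 x})"

definition T_prime_d ::
  "'b set \<Rightarrow> 'a::metric_space set \<Rightarrow> ('a \<times> 'b) set \<Rightarrow> ('a \<times> 'b \<Rightarrow> 'a) \<Rightarrow> ('a \<Rightarrow> real) \<Rightarrow>
   (real \<Rightarrow> real) \<Rightarrow> ('a \<Rightarrow> 'b) \<Rightarrow> 'a \<Rightarrow> 'b set" where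
  "T_prime_d U A D g V \<alpha>3 \<rho>0 x = Psi_d D x \<inter> S_prime_d U A D g V \<alpha>3 \<rho>0 x (V x)"


section \<open>Solutions of hybrid systems without inputs\<close>

definition hybrid_time_domain :: "(real \<times> nat) set \<Rightarrow> bool" where
  "hybrid_time_domain E \<longleftrightarrow> E \<subseteq> {0..} \<times> UNIV \<and>
     (\<forall>(T, J)\<in>E. \<exists>t::nat \<Rightarrow> real. t 0 = 0 \<and> (\<forall>j\<le>J. t j \<le> t (Suc j)) \<and>
        E \<inter> ({0..T} \<times> {0..J}) = (\<Union>j\<le>J. {t j..t (Suc j)} \<times> {j}))"

definition absolutely_continuous_on :: "real set \<Rightarrow> (real \<Rightarrow> 'a::real_normed_vector) \<Rightarrow> bool" where
  "absolutely_continuous_on I h \<longleftrightarrow>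
     (\<forall>\<epsilon>>0. \<exists>\<delta>>0. \<forall>(n::nat) a b.
        (\<forall>i<n. a i \<le> b i \<and> {a i..b i} \<subseteq> I) \<longrightarrow>
        (\<forall>i<n. \<forall>j<n. i \<noteq> j \<longrightarrow> {a i<..<b i} \<inter> {a j<..<b j} = {}) \<longrightarrow>
        (\<Sum>i<n. b i - a i) < \<delta> \<longrightarrow> (\<Sum>i<n. norm (h (b i) - h (a i))) < \<epsilon>)"

text \<open>
  \<open>hybrid_solution C f Dj G E \<phi>\<close>: the arc \<open>\<phi>\<close> with domain \<open>E\<close> (values outside \<open>E\<close> are irrelevant)
  solves \<open>x' = f x\<close> on \<open>C\<close>, \<open>x\<^sup>+ = G x\<close> on \<open>Dj\<close>.  As usual for hybrid arcs, absolute continuity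
  is on each compact interval of flow, and solutions start in \<open>closure C \<union> Dj\<close>.
\<close>

definition hybrid_solution ::
  "'a::euclidean_space set \<Rightarrow> ('a \<Rightarrow> 'a) \<Rightarrow> 'a set \<Rightarrow> ('a \<Rightarrow> 'a) \<Rightarrow> (real \<times> nat) set \<Rightarrow>
   (real \<Rightarrow> nat \<Rightarrow> 'a) \<Rightarrow> bool" where
  "hybrid_solution C f Dj G E \<phi> \<longleftrightarrow>
     hybrid_time_domain E \<and> (0, 0) \<in> E \<and> \<phi> 0 0 \<in> closure C \<union> Dj \<and>
     (\<forall>j. let I = {t. (t, j) \<in> E} in
        (\<forall>a b. {a..b} \<subseteq> I \<longrightarrow> absolutely_continuous_on {a..b} (\<lambda>t. \<phi> t j)) \<and>
        (\<forall>t\<in>interior I. \<phi> t j \<in> C) \<and>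
        (\<exists>N. negligible N \<and>
           (\<forall>t\<in>interior I - N. ((\<lambda>s. \<phi> s j) has_vector_derivative f (\<phi> t j)) (at t)))) \<and>
     (\<forall>t j. (t, j) \<in> E \<and> (t, Suc j) \<in> E \<longrightarrow> \<phi> t j \<in> Dj \<and> \<phi> t (Suc j) = G (\<phi> t j))"

definition maximal_hybrid_solution ::
  "'a::euclidean_space set \<Rightarrow> ('a \<Rightarrow> 'a) \<Rightarrow> 'a set \<Rightarrow> ('a \<Rightarrow> 'a) \<Rightarrow> (real \<times> nat) set \<Rightarrow>
   (real \<Rightarrow> nat \<Rightarrow> 'a) \<Rightarrow> bool" where
  "maximal_hybrid_solution C f Dj G E \<phi> \<longleftrightarrow> hybrid_solution C f Dj G E \<phi> \<and>
     \<not> (\<exists>E' \<phi>'. hybrid_solution C f Dj G E' \<phi>' \<and> E \<subset> E' \<and> (\<forall>(t, j)\<in>E. \<phi>' t j = \<phi> t j))"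

definition complete_domain :: "(real \<times> nat) set \<Rightarrow> bool" where
  "complete_domain E \<longleftrightarrow> (\<forall>M::real. \<exists>(t, j)\<in>E. t + real j > M)"

definition asymptotically_stable ::
  "'a::euclidean_space set \<Rightarrow> ('a \<Rightarrow> 'a) \<Rightarrow> 'a set \<Rightarrow> ('a \<Rightarrow> 'a) \<Rightarrow> 'a set \<Rightarrow> bool" where
  "asymptotically_stable C f Dj G K \<longleftrightarrow>
     (\<forall>\<epsilon>>0. \<exists>\<delta>>0. \<forall>E \<phi>. maximal_hybrid_solution C f Dj G E \<phi> \<and> \<phi> 0 0 \<in> (\<Union>k\<in>K. cball k \<delta>) \<longrightarrow>
        (\<forall>(t, j)\<in>E. \<phi> t j \<in> (\<Union>k\<in>K. cball k \<epsilon>))) \<and>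
     (\<forall>E \<phi>. maximal_hybrid_solution C f Dj G E \<phi> \<longrightarrow>
        bounded ((\<lambda>(t, j). \<phi> t j) ` E) \<and>
        (complete_domain E \<longrightarrow>
           (\<forall>\<epsilon>>0. \<exists>M::real. \<forall>(t, j)\<in>E. t + real j \<ge> M \<longrightarrow> infdist (\<phi> t j) K < \<epsilon>)))"

text \<open>
  Closed loop under a feedback \<open>\<rho>\<close> taking values in \<open>U\<close> on the projection of \<open>D\<close>.  Values of
  \<open>\<rho>\<close> at other points play no role, since \<open>(x, \<rho> x) \<in> D\<close> and \<open>D \<subseteq> UNIV \<times> U\<close> put \<open>x\<close> in that projection.
\<close>

definition renders_asymptotically_stable ::
  "'a::euclidean_space set \<Rightarrow> ('a \<Rightarrow> 'a) \<Rightarrow> ('a \<times> 'b) set \<Rightarrow> ('a \<times> 'b \<Rightarrow> 'a) \<Rightarrow> ('a \<Rightarrow> 'b) \<Rightarrow>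
   'a set \<Rightarrow> bool" where
  "renders_asymptotically_stable C f D g \<rho> K \<longleftrightarrow>
     asymptotically_stable C f {x. (x, \<rho> x) \<in> D} (\<lambda>x. g (x, \<rho> x)) K"

end

theory Submission
  imports Defs
begin

text \<open>
  Both halves of the theorem combine a Lyapunov argument for the closed loop with a continuity
  argument for the minimal-norm selection.

  \<^emph>\<open>Stability.\<close> Along flows \<open>V\<close> decreases at the rate \<open>\<alpha>3\<close>. The feedback takes values in \<open>T_d\<close>
  above a level \<open>r\<close>, so jumps also decrease \<open>V\<close> by \<open>\<alpha>3\<close> there, and it is chosen so that no jump
  leaves \<open>{V \<le> r}\<close>. Hence the sublevel sets above \<open>r\<close> are invariant, and a solution that still
  has \<open>V > r + \<eta>\<close> at hybrid time \<open>(t, j)\<close> has lost at least \<open>m * (t + j)\<close>, where \<open>m > 0\<close> bounds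
  \<open>\<alpha>3\<close> from below on the compact range of distances that can occur; so \<open>t + j\<close> is bounded.
  This is \<open>lyapunov_asymptotically_stable\<close>. For \<open>r > 0\<close> the target is \<open>{V \<le> r}\<close>, and below the
  level \<open>r\<close> any input whose jump ends below \<open>r\<close> will do; one exists because the infimum in the
  jump inequality is less than \<open>r\<close>. For \<open>r = 0\<close> the target is \<open>A\<close>: a jump from \<open>A\<close> uses the zero
  input, and since every point of the jump set starts a maximal solution of the discrete system with
  zero input (\<open>discrete_maximal_solution\<close>), the invariance hypothesis says that this jump stays
  in \<open>A\<close>.

  Differentiating \<open>V\<close> along a solution needs an analytic preliminary. A flow arc is only absolutely
  continuous and satisfies the differential equation almost everywhere, but as \<open>f\<close> is continuous, the
  fundamental theorem of calculus for absolutely continuous functions makes it continuously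
  differentiable, so the mean value theorem applies to \<open>V\<close> along the arc.

  \<^emph>\<open>Continuity.\<close> Where \<open>V > 0\<close>, strictness of the rate gives an input at which the inequality
  defining \<open>T_d\<close> is strict. Moving from any point of \<open>T_d x\<close> a little towards this input keeps it in
  \<open>Psi_d D x\<close> and, by convexity, makes the inequality strict; a strict inequality survives small
  perturbations, so \<open>T_d\<close> inherits lower semicontinuity from \<open>Psi_d D\<close>. It also has a closed graph
  and closed convex values, which makes its element of minimal norm unique and continuous. At
  points where \<open>V\<close> vanishes the minimal-norm value is \<open>0\<close>, and lower semicontinuity of \<open>T'\<close>
  supplies feasible inputs tending to \<open>0\<close>, which dominate the minimal ones in norm.
\<close>


section \<open>Absolutely continuous functions\<close>

lemma absolutely_continuous_on_finite_family:
  assumes "absolutely_continuous_on I h" "\<epsilon> > 0"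
  shows "\<exists>\<delta>>0. (\<forall>(Q::'i set) l u. finite Q \<longrightarrow>
       (\<forall>i\<in>Q. l i \<le> u i \<and> {l i..u i} \<subseteq> I) \<longrightarrow>
       disjoint_family_on (\<lambda>i. {l i<..<u i}) Q \<longrightarrow> (\<Sum>i\<in>Q. u i - l i) < \<delta> \<longrightarrow>
       (\<Sum>i\<in>Q. norm (h (u i) - h (l i))) < \<epsilon>)"
proof -
  obtain \<delta> where "\<delta> > 0" and \<delta>: "\<forall>(n::nat) a b. (\<forall>i<n. a i \<le> b i \<and> {a i..b i} \<subseteq> I) \<longrightarrow>
        (\<forall>i<n. \<forall>j<n. i \<noteq> j \<longrightarrow> {a i<..<b i} \<inter> {a j<..<b j} = {}) \<longrightarrow>
        (\<Sum>i<n. b i - a i) < \<delta> \<longrightarrow> (\<Sum>i<n. norm (h (b i) - h (a i))) < \<epsilon>"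
    using assms(1)[unfolded absolutely_continuous_on_def, THEN spec, THEN mp, OF assms(2)]
    by (elim exE conjE) (rule that)
  have "(\<Sum>i\<in>Q. norm (h (u i) - h (l i))) < \<epsilon>"
    if "finite Q" and le: "\<forall>i\<in>Q. l i \<le> u i \<and> {l i..u i} \<subseteq> I"
      and disj: "disjoint_family_on (\<lambda>i. {l i<..<u i}) Q" and sum: "(\<Sum>i\<in>Q. u i - l i) < \<delta>"
    for Q :: "'i set" and l u
  proof -
    obtain e where e: "bij_betw e {..<card Q} Q"
      using ex_bij_betw_nat_finite[OF \<open>finite Q\<close>] by (auto simp: atLeast0LessThan)
    have eQ: "e i \<in> Q" if "i < card Q" for i
      using e that by (auto simp: bij_betw_def)
    have inj: "e i \<noteq> e j" if "i < card Q" "j < card Q" "i \<noteq> j" for i j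
      using e that by (auto simp: bij_betw_def inj_on_def)
    have "(\<Sum>i<card Q. norm (h (u (e i)) - h (l (e i)))) < \<epsilon>"
    proof (rule \<delta>[rule_format])
      show "(\<Sum>i<card Q. u (e i) - l (e i)) < \<delta>"
        using sum sum.reindex_bij_betw[OF e, of "\<lambda>i. u i - l i"] by simp
      show "{l (e i)<..<u (e i)} \<inter> {l (e j)<..<u (e j)} = {}" if "i < card Q" "j < card Q" "i \<noteq> j" for i j
        using disj eQ[OF that(1)] eQ[OF that(2)] inj[OF that] unfolding disjoint_family_on_def by blast
    qed (use le eQ in auto)
    then show ?thesis
      using sum.reindex_bij_betw[OF e, of "\<lambda>i. norm (h (u i) - h (l i))"] by simp
  qed
  with \<open>\<delta> > 0\<close> show ?thesis by blast
qed

lemma absolutely_continuous_on_imp_continuous_on: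
  fixes h :: "real \<Rightarrow> 'a::real_normed_vector"
  assumes "absolutely_continuous_on {a..b} h"
  shows "continuous_on {a..b} h"
proof (unfold continuous_on_iff, intro ballI allI impI)
  fix x e :: real assume x: "x \<in> {a..b}" and "0 < e"
  obtain \<delta> where "\<delta> > 0" and \<delta>: 
"(\<forall>(Q::unit set) l u. finite Q \<longrightarrow>
       (\<forall>i\<in>Q. l i \<le> u i \<and> {l i..u i} \<subseteq> {a..b}) \<longrightarrow>
       disjoint_family_on (\<lambda>i. {l i<..<u i}) Q \<longrightarrow> (\<Sum>i\<in>Q. u i - l i) < \<delta> \<longrightarrow>
       (\<Sum>i\<in>Q. norm (h (u i) - h (l i))) < e)"
    using absolutely_continuous_on_finite_family[OF assms \<open>0 < e\<close>] by blast
  have "dist (h y) (h x) < e" if "y \<in> {a..b}" "dist y x < \<delta>" for y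
    using \<delta>[rule_format, of UNIV "\<lambda>_. min x y" "\<lambda>_. max x y"] x that
    by (cases "x \<le> y") (auto simp: dist_norm disjoint_family_on_def norm_minus_commute)
  with \<open>\<delta> > 0\<close> show "\<exists>d>0. \<forall>x'\<in>{a..b}. dist x' x < d \<longrightarrow> dist (h x') (h x) < e"
    by blast
qed

text \<open>
  In a fine tagged division the intervals tagged outside the exceptional set are handled by
  differentiability. Those tagged in the null set \<open>N\<close> lie in an open set of small measure, so their
  total length is small and absolute continuity bounds the total increment of \<open>h\<close> over them.
  Replacing \<open>v\<close> by \<open>0\<close> on the null set changes no integral and removes its uncontrolled values there
  from the Riemann sums.
\<close>

theorem fundamental_theorem_of_calculus_absolutely_continuous:
  fixes h :: "real \<Rightarrow> 'a::euclidean_space"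
  assumes ac: "absolutely_continuous_on {a..b} h" and "a \<le> b" and "negligible N"
    and deriv: "\<And>t. t \<in> {a<..<b} - N \<Longrightarrow> (h has_vector_derivative v t) (at t)"
  shows "(v has_integral h b - h a) {a..b}"
proof -
  \<comment> \<open>The end points join the null set because only two-sided derivatives inside the
    interval are given.\<close>
  define N' where "N' = insert a (insert b N)"
  define w where "w t = (if t \<in> N' then 0 else v t)" for t
  have N': "negligible N'"
    using \<open>negligible N\<close> by (simp add: N'_def)
  have "(w has_integral h b - h a) {a..b}"
    unfolding has_integral_real
  proof (intro allI impI)
    fix e :: real assume "e > 0"
    define e1 where "e1 = e / (2 * (b - a + 1))"
    have "e1 > 0" using \<open>e > 0\<close> \<open>a \<le> b\<close> by (simp add: e1_def)
    have e1: "e1 * (b - a) < e / 2"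
      using \<open>e > 0\<close> \<open>a \<le> b\<close> by (simp add: e1_def field_simps)
    obtain \<delta> where "\<delta> > 0" and \<delta>: 
"(\<forall>(Q::(real \<times> real set) set) l u. finite Q \<longrightarrow>
       (\<forall>i\<in>Q. l i \<le> u i \<and> {l i..u i} \<subseteq> {a..b}) \<longrightarrow>
       disjoint_family_on (\<lambda>i. {l i<..<u i}) Q \<longrightarrow> (\<Sum>i\<in>Q. u i - l i) < \<delta> \<longrightarrow>
       (\<Sum>i\<in>Q. norm (h (u i) - h (l i))) < e / 2)"
      using absolutely_continuous_on_finite_family[OF ac, of "e / 2"] \<open>e > 0\<close> half_gt_zero by blast
    have null: "N' \<in> null_sets lebesgue"
      using N' by (simp add: negligible_iff_null_sets)
    obtain W where W: "open W" "N' \<subseteq> W" "W - N' \<in> lmeasurable" "emeasure lebesgue (W - N') < ennreal \<delta>"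
      using sets_lebesgue_outer_open[of N' \<delta>] \<open>\<delta> > 0\<close> null by blast
    have W_meas: "W \<in> lmeasurable"
    proof -
      have "W = (W - N') \<union> N'" using W by blast
      moreover have "N' \<in> lmeasurable" using N' by (simp add: negligible_imp_measurable)
      ultimately show ?thesis using W(3) by (metis fmeasurable.Un)
    qed
    have "measure lebesgue (W - N') < \<delta>"
      using W \<open>\<delta> > 0\<close> by (metis emeasure_eq_measure2 ennreal_less_iff measure_nonneg)
    then have W\<delta>: "measure lebesgue W < \<delta>"
      using W_meas null by (metis measure_Diff_null_set fmeasurableD)
    have "\<exists>d>0. \<forall>y. \<bar>y - t\<bar> < d \<longrightarrow> norm (h y - h t - (y - t) *\<^sub>R v t) \<le> e1 * \<bar>y - t\<bar>"
      if "t \<in> {a..b} - N'" for t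
    proof -
      have "(h has_vector_derivative v t) (at t)"
        using that by (intro deriv) (auto simp: N'_def)
      then show ?thesis
        using \<open>e1 > 0\<close> unfolding has_vector_derivative_def has_derivative_at_alt real_norm_def by blast
    qed
    then obtain d where d: "\<And>t. t \<in> {a..b} - N' \<Longrightarrow> d t > 0"
      "\<And>t y. \<lbrakk>t \<in> {a..b} - N'; \<bar>y - t\<bar> < d t\<rbrakk> \<Longrightarrow> norm (h y - h t - (y - t) *\<^sub>R v t) \<le> e1 * \<bar>y - t\<bar>"
      by metis
    define \<gamma> where "\<gamma> t = (if t \<in> N' then W else if t \<in> {a..b} then ball t (d t) else UNIV)" for t
    have gauge: "gauge \<gamma>"
      using W d(1) by (auto simp: gauge_def \<gamma>_def)
    have estimate: "norm ((\<Sum>(x, K)\<in>p. measure lborel K *\<^sub>R w x) - (h b - h a)) < e"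
      if p: "p tagged_division_of {a..b}" and fine: "\<gamma> fine p" for p
    proof -
      have "finite p" using p by blast
      define q where "q = {z \<in> p. fst z \<in> N'}"
      have q: "q \<subseteq> p" "finite q" using \<open>finite p\<close> by (auto simp: q_def)
      have K: "\<exists>l u. K = {l..u} \<and> l \<le> x \<and> x \<le> u \<and> Inf K = l \<and> Sup K = u \<and> a \<le> l \<and> u \<le> b
          \<and> measure lborel K = u - l \<and> interior K = {l<..<u}"
        if xK: "(x, K) \<in> p" for x K
      proof -
        obtain l u where lu: "K = cbox l u"
          using tagged_division_ofD(4)[OF p xK] by blast
        have x: "x \<in> K" "K \<subseteq> {a..b}"
          using tagged_division_ofD(2,3)[OF p xK] by auto
        then show ?thesis
          unfolding lu cbox_interval interior_atLeastAtMost_real by (intro exI[of _ l] exI[of _ u]) (simp add: lu)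
      qed
      have outside: "norm (measure lborel K *\<^sub>R w x - (h (Sup K) - h (Inf K))) \<le> e1 * (Sup K - Inf K)"
        if xK: "(x, K) \<in> p - q" for x K
      proof -
        obtain l u where lu: "K = {l..u}" "l \<le> x" "x \<le> u" "Inf K = l" "Sup K = u" "a \<le> l" "u \<le> b"
          "measure lborel K = u - l" using K xK by blast
        have x: "x \<in> {a..b} - N'" using xK lu by (auto simp: q_def)
        have "K \<subseteq> ball x (d x)"
        proof -
          have "K \<subseteq> \<gamma> x" using fine xK by (auto simp: fine_def)
          then show ?thesis using x by (auto simp: \<gamma>_def)
        qed
        moreover have "l \<in> K" "u \<in> K"
          using lu by auto
        ultimately have "l \<in> ball x (d x)" "u \<in> ball x (d x)"
          by blast+
        then have bounds: "norm (h l - h x - (l - x) *\<^sub>R v x) \<le> e1 * \<bar>l - x\<bar>"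
          "norm (h u - h x - (u - x) *\<^sub>R v x) \<le> e1 * \<bar>u - x\<bar>"
          using x by (auto intro!: d(2) simp: dist_real_def)
        have split: "measure lborel K *\<^sub>R w x - (h (Sup K) - h (Inf K))
            = (h l - h x - (l - x) *\<^sub>R v x) - (h u - h x - (u - x) *\<^sub>R v x)"
          using x lu by (simp add: w_def algebra_simps)
        have "norm (measure lborel K *\<^sub>R w x - (h (Sup K) - h (Inf K))) \<le> e1 * \<bar>l - x\<bar> + e1 * \<bar>u - x\<bar>"
          unfolding split by (rule norm_triangle_le_diff[OF add_mono[OF bounds]])
        also have "\<dots> = e1 * (Sup K - Inf K)"
          using lu by (simp add: algebra_simps)
        finally show ?thesis .
      qed
      have inside: "(\<Sum>(x,K)\<in>q. norm (h (Sup K) - h (Inf K))) < e / 2"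
      proof -
        have disj: "disjoint_family_on (\<lambda>z. interior (snd z)) q"
          unfolding disjoint_family_on_def
          using tagged_division_ofD(5)[OF p] q(1) by (metis prod.collapse subsetD)
        have lu: "interior (snd z) = {Inf (snd z)<..<Sup (snd z)} \<and> Inf (snd z) \<le> Sup (snd z)
           \<and> {Inf (snd z)..Sup (snd z)} \<subseteq> {a..b} \<and> snd z = {Inf (snd z)..Sup (snd z)}" if "z \<in> q" for z
        proof -
          have "(fst z, snd z) \<in> p" using that q by auto
          from K[OF this] show ?thesis by (elim exE conjE) auto
        qed
        have subW: "snd z \<subseteq> W" if "z \<in> q" for z
        proof -
          have "(fst z, snd z) \<in> p" "fst z \<in> N'" using that by (auto simp: q_def)
          then have "snd z \<subseteq> \<gamma> (fst z)" using fine by (metis fineD)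
          with \<open>fst z \<in> N'\<close> show ?thesis by (simp add: \<gamma>_def)
        qed
        have "(\<Sum>z\<in>q. Sup (snd z) - Inf (snd z)) = (\<Sum>z\<in>q. measure lebesgue (interior (snd z)))"
        proof (intro sum.cong refl)
          fix z assume "z \<in> q"
          then have z: "interior (snd z) = {Inf (snd z)<..<Sup (snd z)}" "Inf (snd z) \<le> Sup (snd z)"
            using lu by auto
          show "Sup (snd z) - Inf (snd z) = measure lebesgue (interior (snd z))"
            unfolding z(1) using z(2) by simp
        qed
        also have "\<dots> = measure lebesgue (\<Union>z\<in>q. interior (snd z))"
        proof (rule measure_finite_Union[symmetric])
          show "emeasure lebesgue (interior (snd z)) \<noteq> \<infinity>" if "z \<in> q" for z
          proof -
            have "interior (snd z) = box (Inf (snd z)) (Sup (snd z))"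
              using lu[OF that] by simp
            then show ?thesis by (metis lmeasurable_box fmeasurableD2 infinity_ennreal_def)
          qed
        qed (use q disj in auto)
        also have "\<dots> \<le> measure lebesgue W"
          using W_meas subW q by (intro measure_mono_fmeasurable UN_least order_trans[OF interior_subset]) auto
        finally have "(\<Sum>z\<in>q. Sup (snd z) - Inf (snd z)) < \<delta>"
          using W\<delta> by simp
        then have "(\<Sum>z\<in>q. norm (h (Sup (snd z)) - h (Inf (snd z)))) < e / 2"
        proof (intro \<delta>[rule_format, OF q(2)])
          show "disjoint_family_on (\<lambda>z. {Inf (snd z)<..<Sup (snd z)}) q"
            using disj unfolding disjoint_family_on_def by (metis lu)
        qed (use lu in meson)+
        then show ?thesis by (simp add: case_prod_beta)
      qed
      have "(\<Sum>(x, K)\<in>p. measure lborel K *\<^sub>R w x) - (h b - h a)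
          = (\<Sum>(x, K)\<in>p. measure lborel K *\<^sub>R w x - (h (Sup K) - h (Inf K)))"
        using additive_tagged_division_1[OF \<open>a \<le> b\<close> p, of h]
        by (simp add: case_prod_beta sum_subtractf)
      also have "\<dots> = (\<Sum>(x, K)\<in>p-q. measure lborel K *\<^sub>R w x - (h (Sup K) - h (Inf K)))
          + (\<Sum>(x, K)\<in>q. measure lborel K *\<^sub>R w x - (h (Sup K) - h (Inf K)))"
        by (rule sum.subset_diff[OF q(1) \<open>finite p\<close>])
      also have "norm \<dots> \<le> (\<Sum>(x, K)\<in>p-q. e1 * (Sup K - Inf K)) + (\<Sum>(x,K)\<in>q. norm (h (Sup K) - h (Inf K)))"
      proof (intro norm_triangle_le add_mono sum_norm_le; safe)
        fix x K assume "(x, K) \<in> q"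
        then show "norm (measure lborel K *\<^sub>R w x - (h (Sup K) - h (Inf K))) \<le> norm (h (Sup K) - h (Inf K))"
          by (simp add: q_def w_def norm_minus_commute)
      qed (use outside in auto)
      also have "(\<Sum>(x, K)\<in>p-q. e1 * (Sup K - Inf K)) \<le> (\<Sum>(x, K)\<in>p. e1 * (Sup K - Inf K))"
      proof (rule sum_mono2[OF \<open>finite p\<close>])
        fix z assume "z \<in> p - (p - q)"
        then have "(fst z, snd z) \<in> p" by simp
        from K[OF this] have "0 \<le> Sup (snd z) - Inf (snd z)" by (elim exE conjE) linarith
        then show "0 \<le> (case z of (x, K) \<Rightarrow> e1 * (Sup K - Inf K))"
          using \<open>e1 > 0\<close> by (simp add: case_prod_beta)
      qed auto
      also have "\<dots> = e1 * (b - a)"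
        using additive_tagged_division_1[OF \<open>a \<le> b\<close> p, of "\<lambda>x. x"]
        by (simp add: case_prod_beta sum_distrib_left[symmetric])
      finally show ?thesis
        using inside e1 by linarith
    qed
    show "\<exists>\<gamma>. gauge \<gamma> \<and> (\<forall>p. p tagged_division_of {a..b} \<and> \<gamma> fine p \<longrightarrow>
        norm ((\<Sum>(x, K)\<in>p. measure lborel K *\<^sub>R w x) - (h b - h a)) < e)"
    proof (intro exI[of _ \<gamma>] conjI allI impI)
      fix p assume "p tagged_division_of {a..b} \<and> \<gamma> fine p"
      then show "norm ((\<Sum>(x, K)\<in>p. measure lborel K *\<^sub>R w x) - (h b - h a)) < e"
        by (elim conjE) (rule estimate)
    qed (rule gauge)
  qed
  then show ?thesis
    by (rule has_integral_spike[OF N', rotated]) (simp add: w_def)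
qed


section \<open>Hybrid time domains and flow arcs\<close>

text \<open>
  The definition of a hybrid time domain allows branching: \<open>{0..2} \<times> {0} \<union> {(1, 1)}\<close> satisfies it,
  so its points need not be ordered. What every point \<open>(T, J)\<close> does have is a chain of flow intervals
  and jumps inside \<open>E\<close> that leads to it from \<open>(0, 0)\<close>, and a property is carried along this chain.
  All statements about solutions below are therefore phrased relative to the initial point.
\<close>

lemma hybrid_domain_induct:
  assumes "hybrid_time_domain E" "(T, J) \<in> E" "P 0 0"
    and flow: "\<And>a b j. \<lbrakk>a < b; {a..b} \<times> {j} \<subseteq> E; P a j\<rbrakk> \<Longrightarrow> P b j"
    and jump: "\<And>t j. \<lbrakk>(t, j) \<in> E; (t, Suc j) \<in> E; P t j\<rbrakk> \<Longrightarrow> P t (Suc j)"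
  shows "P T J"
proof -
  have "\<exists>t::nat \<Rightarrow> real. t 0 = 0 \<and> (\<forall>j\<le>J. t j \<le> t (Suc j)) \<and>
        E \<inter> ({0..T} \<times> {0..J}) = (\<Union>j\<le>J. {t j..t (Suc j)} \<times> {j})"
    using assms(1,2) unfolding hybrid_time_domain_def by blast
  then obtain t :: "nat \<Rightarrow> real" where t: "t 0 = 0" "\<And>j. j \<le> J \<Longrightarrow> t j \<le> t (Suc j)"
    and E: "E \<inter> ({0..T} \<times> {0..J}) = (\<Union>j\<le>J. {t j..t (Suc j)} \<times> {j})"
    by blast
  have segment: "{t j..t (Suc j)} \<times> {j} \<subseteq> E" if "j \<le> J" for j
    using E that by blast
  have flow': "P b j" if "{a..b} \<times> {j} \<subseteq> E" "a \<le> b" "P a j" for a b j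
    using flow[of a b j] that by (cases "a = b") auto
  have start: "P (t j) j" if "j \<le> J" for j
    using that
  proof (induction j)
    case 0
    then show ?case using t assms(3) by simp
  next
    case (Suc j)
    then have "P (t (Suc j)) j"
      using flow'[OF segment t(2)] by simp
    moreover have "(t (Suc j), j) \<in> E" "(t (Suc j), Suc j) \<in> E"
      using segment[of j] segment[of "Suc j"] t(2)[of j] t(2)[of "Suc j"] Suc.prems by auto
    ultimately show ?case by (rule jump[rotated 2])
  qed
  have "0 \<le> T"
    using assms(1,2) unfolding hybrid_time_domain_def by auto
  then have "(T, J) \<in> E \<inter> ({0..T} \<times> {0..J})"
    using assms(2) by auto
  then have T: "t J \<le> T" "T \<le> t (Suc J)"
    unfolding E by auto
  have "{t J..T} \<times> {J} \<subseteq> E"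
    using segment[of J] T by fastforce
  then show ?thesis
    using flow' T start[of J] by blast
qed

context
  fixes C :: "'a::euclidean_space set" and f :: "'a \<Rightarrow> 'a" and \<phi> :: "real \<Rightarrow> nat \<Rightarrow> 'a"
    and E Dj G and a b :: real and j :: nat
  assumes sol: "hybrid_solution C f Dj G E \<phi>" and C: "closed C" and f: "continuous_on UNIV f"
    and ab: "a < b" "{a..b} \<times> {j} \<subseteq> E"
begin

lemma hybrid_solution_flow_continuous: "continuous_on {a..b} (\<lambda>t. \<phi> t j)"
proof -
  have "{a..b} \<subseteq> {t. (t, j) \<in> E}" using ab by auto
  then show ?thesis
    using sol absolutely_continuous_on_imp_continuous_on unfolding hybrid_solution_def Let_def by blast
qed

lemma hybrid_solution_flow_interior: "{a<..<b} \<subseteq> interior {t. (t, j) \<in> E}"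
  using ab by (intro interior_maximal) auto

lemma hybrid_solution_flow_in_C:
  assumes "t \<in> {a..b}"
  shows "\<phi> t j \<in> C"
proof -
  have "(\<lambda>t. \<phi> t j) ` closure {a<..<b} \<subseteq> C"
  proof (rule image_closure_subset)
    show "continuous_on (closure {a<..<b}) (\<lambda>t. \<phi> t j)"
      using hybrid_solution_flow_continuous ab by simp
    show "(\<lambda>t. \<phi> t j) ` {a<..<b} \<subseteq> C"
      using sol hybrid_solution_flow_interior unfolding hybrid_solution_def Let_def by blast
  qed (rule C)
  then show ?thesis using assms ab by auto
qed

text \<open>
  Integrating the differential equation by the fundamental theorem for absolutely continuous functions
  gives \<open>\<phi> x j = \<phi> a j + integral {a..x} (f \<circ> \<phi>)\<close> for all \<open>x\<close>. The integrand is continuous, so the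
  right-hand side is differentiable at every interior point and not just at almost every one.
\<close>

lemma hybrid_solution_flow_derivative:
  assumes t: "t \<in> {a<..<b}"
  shows "((\<lambda>s. \<phi> s j) has_vector_derivative f (\<phi> t j)) (at t)"
proof -
  obtain N where N: "negligible N"
    "\<forall>t\<in>interior {t. (t, j) \<in> E} - N. ((\<lambda>s. \<phi> s j) has_vector_derivative f (\<phi> t j)) (at t)"
    using sol unfolding hybrid_solution_def Let_def by blast
  have int: "((\<lambda>s. f (\<phi> s j)) has_integral \<phi> x j - \<phi> a j) {a..x}" if x: "x \<in> {a..b}" for x
  proof (rule fundamental_theorem_of_calculus_absolutely_continuous[OF _ _ N(1)])
    have "{a..x} \<subseteq> {t. (t, j) \<in> E}" using ab x by auto
    then show "absolutely_continuous_on {a..x} (\<lambda>t. \<phi> t j)"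
      using sol unfolding hybrid_solution_def Let_def by blast
    show "((\<lambda>t. \<phi> t j) has_vector_derivative f (\<phi> t j)) (at t)" if "t \<in> {a<..<x} - N" for t
    proof -
      have "t \<in> {a<..<b}" using that x by auto
      then show ?thesis
        using that N(2) hybrid_solution_flow_interior by blast
    qed
  qed (use x in auto)
  have "continuous_on {a..b} (\<lambda>s. f (\<phi> s j))"
    by (rule continuous_on_compose2[OF f hybrid_solution_flow_continuous]) auto
  then have "((\<lambda>x. integral {a..x} (\<lambda>s. f (\<phi> s j))) has_vector_derivative f (\<phi> t j)) (at t within {a..b})"
    using t by (intro integral_has_vector_derivative) auto
  then have "((\<lambda>x. \<phi> a j + integral {a..x} (\<lambda>s. f (\<phi> s j))) has_vector_derivative 0 + f (\<phi> t j)) (at t within {a..b})"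
    by (intro has_vector_derivative_add has_vector_derivative_const)
  then have "((\<lambda>s. \<phi> s j) has_vector_derivative 0 + f (\<phi> t j)) (at t within {a..b})"
    by (rule has_vector_derivative_transform[rotated 2])
      (use t integral_unique[OF int] in auto)
  then show ?thesis
    using t by (simp add: at_within_Icc_at)
qed

lemma lyapunov_decrease_along_flow:
  assumes "continuous_on UNIV V" and grad: "\<And>x. x \<in> C \<Longrightarrow> GDERIV V x :> dV x"
    and m: "\<And>t. t \<in> {a<..<b} \<Longrightarrow> dV (\<phi> t j) \<bullet> f (\<phi> t j) \<le> - m"
  shows "V (\<phi> b j) \<le> V (\<phi> a j) - m * (b - a)"
proof -
  have "V (\<phi> b j) + m * b \<le> V (\<phi> a j) + m * a"
  proof (rule DERIV_nonpos_imp_decreasing_open[where f = "\<lambda>t. V (\<phi> t j) + m * t"])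
    show "\<exists>y. ((\<lambda>t. V (\<phi> t j) + m * t) has_real_derivative y) (at t) \<and> y \<le> 0" if t: "a < t" "t < b" for t
    proof (intro exI conjI)
      have "((\<lambda>s. \<phi> s j) has_derivative (\<lambda>h. h *\<^sub>R f (\<phi> t j))) (at t)"
        using hybrid_solution_flow_derivative[of t] t by (simp add: has_vector_derivative_def)
      moreover have "(V has_derivative (\<lambda>h. h \<bullet> dV (\<phi> t j))) (at (\<phi> t j))"
        using grad hybrid_solution_flow_in_C[of t] t by (simp add: gderiv_def)
      ultimately have "((\<lambda>s. V (\<phi> s j)) has_derivative (\<lambda>h. (h *\<^sub>R f (\<phi> t j)) \<bullet> dV (\<phi> t j))) (at t)"
        by (rule has_derivative_compose)
      then have "((\<lambda>s. V (\<phi> s j)) has_real_derivative dV (\<phi> t j) \<bullet> f (\<phi> t j)) (at t)"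
        unfolding has_field_derivative_def
        by (rule has_derivative_eq_rhs) (auto simp: inner_commute)
      then show "((\<lambda>t. V (\<phi> t j) + m * t) has_real_derivative dV (\<phi> t j) \<bullet> f (\<phi> t j) + m) (at t)"
        by (auto intro!: derivative_eq_intros)
      show "dV (\<phi> t j) \<bullet> f (\<phi> t j) + m \<le> 0"
        using m[of t] t by simp
    qed
    show "continuous_on {a..b} (\<lambda>t. V (\<phi> t j) + m * t)"
      by (intro continuous_intros continuous_on_compose2[OF assms(1) hybrid_solution_flow_continuous]) auto
  qed (use ab in simp)
  then show ?thesis by (simp add: algebra_simps)
qed

end


section \<open>Continuity of minimal-norm selections\<close>

lemma argmin_norm_iff:
  "u \<in> argmin_norm T \<longleftrightarrow> u \<in> T \<and> (\<forall>v\<in>T. norm u \<le> norm v)"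
  by (auto simp: argmin_norm_def is_arg_min_def not_less)

lemma argmin_norm_singleton_of_closed_convex:
  fixes T :: "'b::euclidean_space set"
  assumes "closed T" "convex T" "T \<noteq> {}"
  shows "\<exists>u. argmin_norm T = {u}"
proof -
  have "u = closest_point T 0" if "u \<in> argmin_norm T" for u
    using that closest_point_unique[OF assms(2,1), of u 0] by (simp add: argmin_norm_iff)
  moreover have "closest_point T 0 \<in> argmin_norm T"
    using closest_point_exists[OF assms(1,3), of 0] by (simp add: argmin_norm_iff)
  ultimately show ?thesis by blast
qed

text \<open>
  The inner approximation \<open>\<zeta>\<close> bounds the norms of the minimisers, so they have cluster points; by the
  outer condition each cluster point lies in \<open>S0\<close> and by the norm bound it is minimal there, hence
  equals \<open>u0\<close>. A bounded sequence with a single cluster point converges. The outer condition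
  concerns only subsequences of the minimisers because this is all that a closed graph has to provide.
\<close>

lemma argmin_norm_tendsto:
  fixes u :: "nat \<Rightarrow> 'b::euclidean_space"
  assumes u: "\<And>i. u i \<in> argmin_norm (S i)" and S0: "argmin_norm S0 = {u0}"
    and inner: "\<zeta> \<longlonglongrightarrow> u0" "\<forall>\<^sub>F i in sequentially. \<zeta> i \<in> S i"
    and outer: "\<And>s v. \<lbrakk>strict_mono s; (u \<circ> s) \<longlonglongrightarrow> v\<rbrakk> \<Longrightarrow> v \<in> S0"
  shows "u \<longlonglongrightarrow> u0"
proof (rule ccontr)
  assume "\<not> u \<longlonglongrightarrow> u0"
  then obtain e where "e > 0" and e: "\<not> (\<forall>\<^sub>F i in sequentially. dist (u i) u0 < e)"
    by (auto simp: tendsto_iff)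
  define J where "J = {i. \<not> dist (u i) u0 < e}"
  have "infinite J"
    using e unfolding J_def by (simp add: cofinite_eq_sequentially[symmetric] eventually_cofinite)
  define s where "s = enumerate J"
  have s: "strict_mono s" "\<And>i. s i \<in> J"
    using \<open>infinite J\<close> by (auto simp: s_def strict_mono_enumerate enumerate_in_set)
  have le: "\<forall>\<^sub>F i in sequentially. norm (u i) \<le> norm (\<zeta> i)"
    using inner(2) by eventually_elim (use u in \<open>auto simp: argmin_norm_iff\<close>)
  have "Bseq u"
    using le convergent_imp_Bseq[OF convergentI[OF inner(1)]] by (rule Bseq_eventually_mono)
  then have "bounded (range (u \<circ> s))"
    by (auto simp: Bseq_eq_bounded intro: bounded_subset)
  then obtain v q where q: "strict_mono (q::nat\<Rightarrow>nat)" "((u \<circ> s) \<circ> q) \<longlonglongrightarrow> v"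
    using bounded_imp_convergent_subsequence by metis
  have sq: "strict_mono (s \<circ> q)" using s(1) q(1) by (rule strict_mono_o)
  have "v \<in> S0"
    using outer[OF sq] q(2) by (simp add: o_assoc)
  moreover have "norm v \<le> norm u0"
  proof (rule tendsto_le[OF _ _ tendsto_norm[OF q(2)]])
    show "(\<lambda>i. norm (\<zeta> ((s \<circ> q) i))) \<longlonglongrightarrow> norm u0"
      using LIMSEQ_subseq_LIMSEQ[OF inner(1) sq] by (simp add: o_def tendsto_norm)
    show "\<forall>\<^sub>F i in sequentially. norm (((u \<circ> s) \<circ> q) i) \<le> norm (\<zeta> ((s \<circ> q) i))"
      using eventually_subseq[OF sq le] by simp
  qed simp
  moreover have "\<forall>w\<in>S0. norm u0 \<le> norm w"
    using S0 argmin_norm_iff[of u0 S0] by simp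
  ultimately have "v \<in> argmin_norm S0"
    unfolding argmin_norm_iff by (meson order_trans)
  then have "v = u0" using S0 by simp
  have "\<forall>i. e \<le> dist (((u \<circ> s) \<circ> q) i) u0"
    using s(2) by (simp add: J_def not_less)
  then have "e \<le> dist v u0"
    by (intro tendsto_lowerbound[OF tendsto_dist[OF q(2) tendsto_const]]) (auto intro: always_eventually)
  then show False using \<open>v = u0\<close> \<open>e > 0\<close> by simp
qed

lemma continuous_minimal_norm_selection:
  fixes S :: "'a::metric_space \<Rightarrow> 'b::euclidean_space set"
  assumes "lsc_at S x" "closed (set_graph S)" "x \<in> Y"
    and \<rho>: "\<And>y. y \<in> Y \<Longrightarrow> argmin_norm (S y) = {\<rho> y}"
  shows "continuous (at x within Y) \<rho>"
  unfolding continuous_within_sequentially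
proof (intro allI impI, elim conjE)
  fix \<xi> assume \<xi>Y: "\<forall>n::nat. \<xi> n \<in> Y" and \<xi>: "\<xi> \<longlonglongrightarrow> x"
  have "\<rho> x \<in> S x" using \<rho>[OF \<open>x \<in> Y\<close>] by (auto simp: argmin_norm_iff)
  then obtain \<zeta> where \<zeta>: "\<zeta> \<longlonglongrightarrow> \<rho> x" "\<forall>\<^sub>F i in sequentially. \<zeta> i \<in> S (\<xi> i)"
    using \<open>lsc_at S x\<close> \<xi> unfolding lsc_at_def by blast
  show "(\<rho> \<circ> \<xi>) \<longlonglongrightarrow> \<rho> x"
  proof (rule argmin_norm_tendsto[OF _ \<rho>[OF \<open>x \<in> Y\<close>] \<zeta>])
    show "(\<rho> \<circ> \<xi>) i \<in> argmin_norm (S (\<xi> i))" for i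
      using \<rho> \<xi>Y by simp
    fix s v assume s: "strict_mono (s :: nat \<Rightarrow> nat)" "(\<rho> \<circ> \<xi> \<circ> s) \<longlonglongrightarrow> v"
    have "(\<lambda>i. (\<xi> (s i), \<rho> (\<xi> (s i)))) \<longlonglongrightarrow> (x, v)"
      using LIMSEQ_subseq_LIMSEQ[OF \<xi> s(1)] s(2) by (intro tendsto_Pair) (simp_all add: o_def)
    moreover have "(\<xi> (s i), \<rho> (\<xi> (s i))) \<in> set_graph S" for i
      using \<rho> \<xi>Y by (fastforce simp: set_graph_def argmin_norm_iff)
    ultimately have "(x, v) \<in> set_graph S"
      using \<open>closed (set_graph S)\<close> by (meson closed_sequentially)
    then show "v \<in> S x" by (simp add: set_graph_def)
  qed
qed

text \<open>
  The set of inner limit points is closed, so lower semicontinuity need only be checked up to an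
  arbitrarily small error. Closed values allow projecting \<open>u\<close> itself onto \<open>S (\<xi> i)\<close>: the projections
  are at least as close to \<open>u\<close> as any approximating sequence, which replaces a diagonal argument.
\<close>

lemma lsc_atI_approximable:
  fixes S :: "'a::metric_space \<Rightarrow> 'b::euclidean_space set"
  assumes closed: "\<And>y. closed (S y)"
    and approx: "\<And>u e \<xi>. \<lbrakk>u \<in> S x; e > 0; \<xi> \<longlonglongrightarrow> x\<rbrakk> \<Longrightarrow>
      \<exists>v \<zeta>. dist u v < e \<and> \<zeta> \<longlonglongrightarrow> v \<and> (\<forall>\<^sub>F i in sequentially. \<zeta> i \<in> S (\<xi> i))"
  shows "lsc_at S x"
  unfolding lsc_at_def
proof (intro subsetI CollectI allI impI)
  fix u \<xi> assume u: "u \<in> S x" and \<xi>: "\<xi> \<longlonglongrightarrow> x"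
  define \<zeta> where "\<zeta> i = closest_point (S (\<xi> i)) u" for i
  have near: "\<forall>\<^sub>F i in sequentially. \<zeta> i \<in> S (\<xi> i) \<and> dist (\<zeta> i) u < e" if "e > 0" for e
  proof -
    obtain v \<eta> where v: "dist u v < e" "\<eta> \<longlonglongrightarrow> v" "\<forall>\<^sub>F i in sequentially. \<eta> i \<in> S (\<xi> i)"
      using approx[OF u \<open>e > 0\<close> \<xi>] by blast
    have "(\<lambda>i. dist u (\<eta> i)) \<longlonglongrightarrow> dist u v"
      using v(2) by (intro tendsto_intros)
    then have "\<forall>\<^sub>F i in sequentially. dist u (\<eta> i) < e"
      using v(1) by (rule order_tendstoD(2))
    with v(3) show ?thesis
    proof eventually_elim
      case (elim i)
      then have "S (\<xi> i) \<noteq> {}" by blast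
      from closest_point_exists[OF closed this, of u] elim show ?case
        by (auto simp: \<zeta>_def dist_commute intro: le_less_trans)
    qed
  qed
  show "\<exists>\<zeta>. \<zeta> \<longlonglongrightarrow> u \<and> (\<forall>\<^sub>F i in sequentially. \<zeta> i \<in> S (\<xi> i))"
  proof (intro exI conjI)
    show "\<zeta> \<longlonglongrightarrow> u"
      unfolding tendsto_iff by (intro allI impI eventually_mono[OF near]) auto
    show "\<forall>\<^sub>F i in sequentially. \<zeta> i \<in> S (\<xi> i)"
      by (rule eventually_mono[OF near[of 1]]) auto
  qed
qed

text \<open>
  A Slater-type condition. On the segment from a feasible \<open>u\<close> to the strictly feasible \<open>u0\<close> the
  constraint is strict away from \<open>u\<close>, and points of \<open>P (\<xi> i)\<close> close to such a point satisfy it too by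
  continuity. Without a strictly feasible point the feasible set may collapse under a perturbation.
\<close>

lemma lsc_at_cut_by_strictly_feasible_convex_constraint:
  fixes P :: "'a::metric_space \<Rightarrow> 'b::euclidean_space set" and F :: "'a \<times> 'b \<Rightarrow> real"
  assumes lsc: "lsc_at P x" and closed: "\<And>y. closed (P y)" and F: "continuous_on UNIV F"
    and cvx: "convex (P x)" "convex_on (P x) (\<lambda>u. F (x, u))"
    and u0: "u0 \<in> P x" "F (x, u0) < 0"
  shows "lsc_at (\<lambda>y. {u \<in> P y. F (y, u) \<le> 0}) x"
proof (rule lsc_atI_approximable)
  fix y
  have "continuous_on UNIV (\<lambda>u. F (y, u))"
    by (intro continuous_on_compose2[OF F] continuous_intros) auto
  then have "closed {u. F (y, u) \<le> 0}"
    by (intro closed_Collect_le continuous_intros)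
  then show "closed {u \<in> P y. F (y, u) \<le> 0}"
    using closed[of y] by (simp add: Collect_conj_eq closed_Int)
next
  fix u e \<xi> assume u: "u \<in> {u \<in> P x. F (x, u) \<le> 0}" and "e > (0::real)" and \<xi>: "\<xi> \<longlonglongrightarrow> x"
  define M where "M = norm (u0 - u) + 1"
  have "M > 0" by (simp add: M_def add_nonneg_pos)
  \<comment> \<open>Step length towards \<open>u0\<close>: short enough to stay within
    \<open>e\<close> of \<open>u\<close>.\<close>
  define t where "t = min 1 (e / (2 * M))"
  have t: "0 < t" "t \<le> 1" using \<open>e > 0\<close> \<open>M > 0\<close> by (auto simp: t_def)
  define v where "v = (1 - t) *\<^sub>R u + t *\<^sub>R u0"
  have "v \<in> P x"
    unfolding v_def using cvx(1) u u0 t by (intro convexD) auto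
  have "F (x, v) \<le> (1 - t) * F (x, u) + t * F (x, u0)"
    unfolding v_def using u u0 t by (intro convex_onD[OF cvx(2)]) auto
  also have "\<dots> < 0"
  proof -
    have "(1 - t) * F (x, u) \<le> 0" using u t by (auto intro: mult_nonneg_nonpos)
    moreover have "t * F (x, u0) < 0" using u0 t by (auto intro: mult_pos_neg)
    ultimately show ?thesis by linarith
  qed
  finally have Fv: "F (x, v) < 0" .
  have "dist u v = norm (t *\<^sub>R (u - u0))"
    by (simp add: dist_norm v_def algebra_simps)
  also have "\<dots> = t * norm (u0 - u)"
    using t by (simp add: norm_minus_commute)
  also have "\<dots> \<le> e / (2 * M) * M"
    using \<open>e > 0\<close> \<open>M > 0\<close> by (intro mult_mono) (auto simp: t_def M_def)
  also have "\<dots> = e / 2"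
    using \<open>M > 0\<close> by simp
  also have "\<dots> < e"
    using \<open>e > 0\<close> by simp
  finally have "dist u v < e" .
  obtain \<zeta> where \<zeta>: "\<zeta> \<longlonglongrightarrow> v" "\<forall>\<^sub>F i in sequentially. \<zeta> i \<in> P (\<xi> i)"
    using lsc \<open>v \<in> P x\<close> \<xi> unfolding lsc_at_def by blast
  have "(\<lambda>i. F (\<xi> i, \<zeta> i)) \<longlonglongrightarrow> F (x, v)"
    using F by (intro continuous_on_tendsto_compose[of UNIV F] tendsto_Pair \<xi> \<zeta>) auto
  then have "\<forall>\<^sub>F i in sequentially. F (\<xi> i, \<zeta> i) < 0"
    using Fv by (rule order_tendstoD(2))
  with \<zeta>(2) have "\<forall>\<^sub>F i in sequentially. \<zeta> i \<in> {u \<in> P (\<xi> i). F (\<xi> i, u) \<le> 0}"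
    by eventually_elim auto
  with \<open>dist u v < e\<close> \<zeta>(1) show "\<exists>v \<zeta>. dist u v < e \<and> \<zeta> \<longlonglongrightarrow> v \<and>
      (\<forall>\<^sub>F i in sequentially. \<zeta> i \<in> {u \<in> P (\<xi> i). F (\<xi> i, u) \<le> 0})" by blast
qed


section \<open>A Lyapunov theorem for hybrid systems\<close>

text \<open>
  The level \<open>r\<close> separates the region where jumps must decrease \<open>V\<close> from \<open>{V \<le> r}\<close>, which jumps must
  not leave. \<open>X\<close> is a set that no solution leaves; all bounds on \<open>V\<close> are required only there. The last
  two hypotheses say that \<open>K\<close> and \<open>{V \<le> r}\<close> have the same neighbourhoods in \<open>X\<close>. They are stated
  separately because \<open>V\<close> may take any values on the part of \<open>K\<close> outside \<open>X\<close>, so that \<open>K\<close> need not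
  itself be a sublevel set.
\<close>

theorem lyapunov_asymptotically_stable:
  fixes C :: "'a::euclidean_space set" and V :: "'a \<Rightarrow> real"
  assumes C: "closed C" and f: "continuous_on UNIV f" and V: "continuous_on UNIV V"
    and X: "C \<subseteq> X" "Dj \<subseteq> X" "G ` Dj \<subseteq> X"
    and grad: "\<And>x. x \<in> C \<Longrightarrow> GDERIV V x :> dV x"
    and flow: "\<And>x. x \<in> C \<Longrightarrow> dV x \<bullet> f x \<le> - w x"
    and jump_above: "\<And>x. \<lbrakk>x \<in> Dj; V x > r\<rbrakk> \<Longrightarrow> V (G x) \<le> V x - w x"
    and jump_below: "\<And>x. \<lbrakk>x \<in> Dj; V x \<le> r\<rbrakk> \<Longrightarrow> V (G x) \<le> r"
    and w_nonneg: "\<And>x. x \<in> X \<Longrightarrow> 0 \<le> w x"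
    and w_pos: "\<And>\<eta> M. \<eta> > 0 \<Longrightarrow> \<exists>m>0. \<forall>x\<in>X. r + \<eta> < V x \<and> V x \<le> M \<longrightarrow> m \<le> w x"
    and sublevels_bounded: "\<And>M. bounded {x \<in> X. V x \<le> M}"
    and K: "closed K"
    and V_small_imp_near: "\<And>\<epsilon>. \<epsilon> > 0 \<Longrightarrow> \<exists>\<eta>>0. \<forall>x\<in>X. V x \<le> r + \<eta> \<longrightarrow> infdist x K < \<epsilon>"
    and near_imp_V_small: "\<And>\<eta>. \<eta> > 0 \<Longrightarrow> \<exists>\<delta>>0. \<forall>k\<in>K. \<forall>x\<in>X. dist k x \<le> \<delta> \<longrightarrow> V x \<le> r + \<eta>"
  shows "asymptotically_stable C f Dj G K"
proof -
  have start: "\<phi> 0 0 \<in> X" if "hybrid_solution C f Dj G E \<phi>" for E \<phi>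
    using that X C by (auto simp: hybrid_solution_def)
  have invariant: "\<phi> t j \<in> X \<and> V (\<phi> t j) \<le> max r (V (\<phi> 0 0))"
    if sol: "hybrid_solution C f Dj G E \<phi>" and "(t, j) \<in> E" for E \<phi> t j
  proof (rule hybrid_domain_induct[where P = "\<lambda>t j. \<phi> t j \<in> X \<and> V (\<phi> t j) \<le> max r (V (\<phi> 0 0))", OF _ \<open>(t, j) \<in> E\<close>])
    show "hybrid_time_domain E" using sol by (simp add: hybrid_solution_def)
    show "\<phi> 0 0 \<in> X \<and> V (\<phi> 0 0) \<le> max r (V (\<phi> 0 0))" using start[OF sol] by simp
  next
    fix a b j assume ab: "a < b" "{a..b} \<times> {j} \<subseteq> E" 
      and IH: "\<phi> a j \<in> X \<and> V (\<phi> a j) \<le> max r (V (\<phi> 0 0))"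
    have inC: "\<phi> t j \<in> C" if "t \<in> {a..b}" for t
      using hybrid_solution_flow_in_C[OF sol C f ab that] .
    have "V (\<phi> b j) \<le> V (\<phi> a j) - 0 * (b - a)"
    proof (rule lyapunov_decrease_along_flow[OF sol C f ab V grad])
      fix t assume t: "t \<in> {a<..<b}"
      then have "\<phi> t j \<in> C" using inC by auto
      then show "dV (\<phi> t j) \<bullet> f (\<phi> t j) \<le> - 0"
        using flow w_nonneg X(1) by fastforce
    qed
    then show "\<phi> b j \<in> X \<and> V (\<phi> b j) \<le> max r (V (\<phi> 0 0))"
      using IH inC[of b] ab X(1) by auto
  next
    fix t j assume "(t, j) \<in> E" "(t, Suc j) \<in> E" and IH: "\<phi> t j \<in> X \<and> V (\<phi> t j) \<le> max r (V (\<phi> 0 0))"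
    then have *: "\<phi> t j \<in> Dj" "\<phi> t (Suc j) = G (\<phi> t j)"
      using sol by (auto simp: hybrid_solution_def)
    then show "\<phi> t (Suc j) \<in> X \<and> V (\<phi> t (Suc j)) \<le> max r (V (\<phi> 0 0))"
      using jump_above[OF *(1)] jump_below[OF *(1)] w_nonneg[of "\<phi> t j"] IH X(3)
      by (cases "V (\<phi> t j) > r") (auto simp: max_def split: if_splits)
  qed
  \<comment> \<open>Decay is measured from the initial value, up to the point considered: either
    \<open>V\<close> is already small or it has decreased at the full rate all the way. This makes
    no comparison between points that might lie on different branches of the domain.\<close>
  have attracted: "\<exists>M. \<forall>(t, j)\<in>E. t + real j \<ge> M \<longrightarrow> V (\<phi> t j) \<le> r + \<eta>"
    if sol: "hybrid_solution C f Dj G E \<phi>" and "\<eta> > 0" for E \<phi> \<eta>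
  proof -
    define B where "B = max r (V (\<phi> 0 0))"
    obtain m where m: "m > 0" "\<And>x. \<lbrakk>x \<in> X; r + \<eta> < V x; V x \<le> B\<rbrakk> \<Longrightarrow> m \<le> w x"
      using w_pos[OF \<open>\<eta> > 0\<close>, of B] by blast
    have decay: "V (\<phi> t j) \<le> max (r + \<eta>) (B - m * (t + real j))" if tj: "(t, j) \<in> E" for t j
    proof (rule hybrid_domain_induct[where P = "\<lambda>t j. V (\<phi> t j) \<le> max (r + \<eta>) (B - m * (t + real j))", OF _ tj])
      show "hybrid_time_domain E" using sol by (simp add: hybrid_solution_def)
      show "V (\<phi> 0 0) \<le> max (r + \<eta>) (B - m * (0 + real 0))" by (simp add: B_def)
    next
      fix a b j assume ab: "a < b" "{a..b} \<times> {j} \<subseteq> E" 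
        and IH: "V (\<phi> a j) \<le> max (r + \<eta>) (B - m * (a + real j))"
      show "V (\<phi> b j) \<le> max (r + \<eta>) (B - m * (b + real j))"
      proof (cases "V (\<phi> b j) \<le> r + \<eta>")
        case False
        have inC: "\<phi> t j \<in> C" if "t \<in> {a..b}" for t
          using hybrid_solution_flow_in_C[OF sol C f ab that] .
        \<comment> \<open>As \<open>V\<close> is nonincreasing along the arc, being large at its end
          it was large throughout.\<close>
        have above: "r + \<eta> < V (\<phi> t j)" if t: "t \<in> {a..<b}" for t
        proof -
          have tb: "t < b" "{t..b} \<times> {j} \<subseteq> E" using t ab by auto
          have "V (\<phi> b j) \<le> V (\<phi> t j) - 0 * (b - t)"
          proof (rule lyapunov_decrease_along_flow[OF sol C f tb V grad])
            fix s assume s: "s \<in> {t<..<b}"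
            then have "\<phi> s j \<in> C" using inC t by auto
            then show "dV (\<phi> s j) \<bullet> f (\<phi> s j) \<le> - 0"
              using flow w_nonneg X(1) by fastforce
          qed
          then show ?thesis using False by simp
        qed
        have "V (\<phi> b j) \<le> V (\<phi> a j) - m * (b - a)"
        proof (rule lyapunov_decrease_along_flow[OF sol C f ab V grad])
          fix t assume t: "t \<in> {a<..<b}"
          have "(t, j) \<in> E" using t ab by auto
          then have "m \<le> w (\<phi> t j)"
            using invariant[OF sol, of t j] above[of t] t by (intro m(2)) (auto simp: B_def)
          then show "dV (\<phi> t j) \<bullet> f (\<phi> t j) \<le> - m"
            using flow[of "\<phi> t j"] inC[of t] t by auto
        qed
        moreover have "V (\<phi> a j) \<le> B - m * (a + real j)"
          using IH above[of a] ab by auto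
        ultimately show ?thesis by (simp add: algebra_simps)
      qed simp
    next
      fix t j assume E: "(t, j) \<in> E" "(t, Suc j) \<in> E" 
        and IH: "V (\<phi> t j) \<le> max (r + \<eta>) (B - m * (t + real j))"
      then have *: "\<phi> t j \<in> Dj" "\<phi> t (Suc j) = G (\<phi> t j)"
        using sol by (auto simp: hybrid_solution_def)
      have inv: "\<phi> t j \<in> X" "V (\<phi> t j) \<le> B" using invariant[OF sol E(1)] by (auto simp: B_def)
      show "V (\<phi> t (Suc j)) \<le> max (r + \<eta>) (B - m * (t + real (Suc j)))"
      proof (cases "V (\<phi> t j) \<le> r + \<eta>")
        case True
        then have "V (G (\<phi> t j)) \<le> r + \<eta>"
          using jump_above[OF *(1)] jump_below[OF *(1)] w_nonneg[OF inv(1)] \<open>\<eta> > 0\<close>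
          by (cases "V (\<phi> t j) > r") auto
        then show ?thesis by (simp add: *)
      next
        case False
        then have "V (G (\<phi> t j)) \<le> V (\<phi> t j) - m"
          using jump_above[OF *(1)] m(2)[OF inv(1) _ inv(2)] \<open>\<eta> > 0\<close> by auto
        then show ?thesis using False IH by (auto simp: * algebra_simps)
      qed
    qed
    show ?thesis
    proof (intro exI ballI, clarify)
      \<comment> \<open>From this hybrid time on, decay at the full rate would push \<open>V\<close>
        down to \<open>r\<close>.\<close>
      fix t j assume "(t, j) \<in> E" and tj: "(B - r) / m \<le> t + real j"
      from tj have "B - r \<le> m * (t + real j)" using m(1) by (simp add: field_simps)
      then show "V (\<phi> t j) \<le> r + \<eta>" using decay[OF \<open>(t, j) \<in> E\<close>] \<open>\<eta> > 0\<close> by auto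
    qed
  qed
  show ?thesis
    unfolding asymptotically_stable_def
  proof (intro conjI allI impI)
    fix \<epsilon> :: real assume "\<epsilon> > 0"
    obtain \<eta> where \<eta>: "\<eta> > 0" "\<forall>x\<in>X. V x \<le> r + \<eta> \<longrightarrow> infdist x K < \<epsilon>"
      using V_small_imp_near[OF \<open>\<epsilon> > 0\<close>] by blast
    obtain \<delta> where \<delta>: "\<delta> > 0" "\<forall>k\<in>K. \<forall>x\<in>X. dist k x \<le> \<delta> \<longrightarrow> V x \<le> r + \<eta>"
      using near_imp_V_small[OF \<open>\<eta> > 0\<close>] by blast
    show "\<exists>\<delta>>0. \<forall>E \<phi>. maximal_hybrid_solution C f Dj G E \<phi> \<and> \<phi> 0 0 \<in> (\<Union>k\<in>K. cball k \<delta>) \<longrightarrow>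
        (\<forall>(t, j)\<in>E. \<phi> t j \<in> (\<Union>k\<in>K. cball k \<epsilon>))"
    proof (intro exI conjI allI impI ballI, rule \<delta>(1), clarify)
      fix E \<phi> t j k assume "maximal_hybrid_solution C f Dj G E \<phi>" and tj: "(t, j) \<in> E"
        and k: "k \<in> K" "\<phi> 0 0 \<in> cball k \<delta>"
      then have sol: "hybrid_solution C f Dj G E \<phi>" by (simp add: maximal_hybrid_solution_def)
      have "V (\<phi> 0 0) \<le> r + \<eta>"
        using \<delta>(2) k start[OF sol] by auto
      then have "infdist (\<phi> t j) K < \<epsilon>"
        using invariant[OF sol tj] \<eta> by auto
      moreover obtain y where "y \<in> K" "infdist (\<phi> t j) K = dist (\<phi> t j) y"
        using infdist_attains_inf[OF K] k(1) by blast
      ultimately show "\<phi> t j \<in> (\<Union>k\<in>K. cball k \<epsilon>)"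
        by (auto simp: dist_commute intro!: bexI[of _ y])
    qed
  next
    fix E \<phi> assume "maximal_hybrid_solution C f Dj G E \<phi>"
    then have sol: "hybrid_solution C f Dj G E \<phi>" by (simp add: maximal_hybrid_solution_def)
    have "(\<lambda>(t, j). \<phi> t j) ` E \<subseteq> {x \<in> X. V x \<le> max r (V (\<phi> 0 0))}"
      using invariant[OF sol] by auto
    then show "bounded ((\<lambda>(t, j). \<phi> t j) ` E)"
      using bounded_subset[OF sublevels_bounded] by blast
    fix \<epsilon> :: real assume "\<epsilon> > 0"
    obtain \<eta> where \<eta>: "\<eta> > 0" "\<forall>x\<in>X. V x \<le> r + \<eta> \<longrightarrow> infdist x K < \<epsilon>"
      using V_small_imp_near[OF \<open>\<epsilon> > 0\<close>] by blast
    then show "\<exists>M::real. \<forall>(t, j)\<in>E. t + real j \<ge> M \<longrightarrow> infdist (\<phi> t j) K < \<epsilon>"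
      using attracted[OF sol \<open>\<eta> > 0\<close>] invariant[OF sol] by fast
  qed
qed


section \<open>Maximal solutions of purely discrete systems\<close>

text \<open>
  With an empty flow set no interval of positive length can occur in the domain of a solution, so
  any extension consists of further iterates at time \<open>0\<close>, and all of these are already present.
\<close>

lemma discrete_maximal_solution:
  fixes G :: "'a::euclidean_space \<Rightarrow> 'a"
  assumes "x \<in> P"
  shows "maximal_hybrid_solution {} f P G ({0} \<times> {j. \<forall>i<j. (G ^^ i) x \<in> P}) (\<lambda>t j. (G ^^ j) x)"
    (is "maximal_hybrid_solution _ _ _ _ ?E ?\<phi>")
proof -
  have "hybrid_time_domain ?E"
    unfolding hybrid_time_domain_def
  proof (intro conjI ballI)
    fix z assume "z \<in> ?E"
    then obtain J where z: "z = (0, J)" "\<forall>i<J. (G ^^ i) x \<in> P" by auto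
    have "?E \<inter> ({0..0} \<times> {0..J}) = (\<Union>j\<le>J. {0..0} \<times> {j})"
      using z(2) by (auto dest: less_le_trans)
    then show "case z of (T, J) \<Rightarrow> \<exists>t::nat \<Rightarrow> real. t 0 = 0 \<and> (\<forall>j\<le>J. t j \<le> t (Suc j)) \<and>
        ?E \<inter> ({0..T} \<times> {0..J}) = (\<Union>j\<le>J. {t j..t (Suc j)} \<times> {j})"
      unfolding z by (intro case_prodI exI[of _ "\<lambda>_. 0"]) simp
  qed auto
  moreover have "interior {t. (t, j) \<in> ?E} = {}" for j
    using interior_mono[of "{t. (t, j) \<in> ?E}" "{0}"] by auto
  moreover have "absolutely_continuous_on {a..b} (\<lambda>t. ?\<phi> t j)" for a b j
    by (auto simp: absolutely_continuous_on_def intro!: exI[of _ 1])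
  ultimately have sol: "hybrid_solution {} f P G ?E ?\<phi>"
    using assms unfolding hybrid_solution_def Let_def by (auto intro: exI[of _ "{}"])
  have "E' \<subseteq> ?E" if sol': "hybrid_solution {} f P G E' \<phi>'" and ext: "\<forall>(t, j)\<in>?E. \<phi>' t j = ?\<phi> t j" for E' \<phi>'
  proof (intro subsetI)
    fix z assume "z \<in> E'"
    have "\<phi>' 0 0 = x" using ext by auto
    have "fst z = 0 \<and> (\<forall>i<snd z. (G ^^ i) x \<in> P) \<and> \<phi>' (fst z) (snd z) = (G ^^ snd z) x"
    proof (rule hybrid_domain_induct[where E = E' and P = "\<lambda>t j. t = 0 \<and> (\<forall>i<j. (G ^^ i) x \<in> P) \<and> \<phi>' t j = (G ^^ j) x"])
      show "hybrid_time_domain E'" using sol' by (simp add: hybrid_solution_def)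
      show "(fst z, snd z) \<in> E'" using \<open>z \<in> E'\<close> by simp
    next
      fix a b :: real and j assume ab: "a < b" "{a..b} \<times> {j} \<subseteq> E'"
      have "{a<..<b} \<subseteq> interior {t. (t, j) \<in> E'}"
        using ab by (intro interior_maximal) auto
      then have "(a + b) / 2 \<in> interior {t. (t, j) \<in> E'}"
        using ab(1) by auto
      then have False
        using sol' unfolding hybrid_solution_def Let_def by blast
      then show "b = 0 \<and> (\<forall>i<j. (G ^^ i) x \<in> P) \<and> \<phi>' b j = (G ^^ j) x" ..
    next
      fix t j assume "(t, j) \<in> E'" "(t, Suc j) \<in> E'" and IH: "t = 0 \<and> (\<forall>i<j. (G ^^ i) x \<in> P) \<and> \<phi>' t j = (G ^^ j) x"
      then have "\<phi>' t j \<in> P" "\<phi>' t (Suc j) = G (\<phi>' t j)"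
        using sol' by (auto simp: hybrid_solution_def)
      with IH show "t = 0 \<and> (\<forall>i<Suc j. (G ^^ i) x \<in> P) \<and> \<phi>' t (Suc j) = (G ^^ Suc j) x"
        by (auto simp: less_Suc_eq)
    qed (use \<open>\<phi>' 0 0 = x\<close> in simp)
    then show "z \<in> ?E" by (cases z) auto
  qed
  with sol show ?thesis
    unfolding maximal_hybrid_solution_def by blast
qed


section \<open>Control Lyapunov functions with a strict rate\<close>

lemma class_K_infinity_less_cancel:
  assumes "class_K_infinity \<alpha>" "\<alpha> s < \<alpha> t" "0 \<le> s" "0 \<le> t"
  shows "s < t"
proof (rule ccontr)
  assume "\<not> s < t"
  then have "\<alpha> t \<le> \<alpha> s"
    using assms by (intro strict_mono_on_leD[of "{0..}" \<alpha>]) (auto simp: class_K_infinity_def)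
  with assms(2) show False by simp
qed

lemma class_K_infinity_mono:
  assumes "class_K_infinity \<alpha>" "0 \<le> s" "s \<le> t"
  shows "\<alpha> s \<le> \<alpha> t"
  using assms by (intro strict_mono_on_leD[of "{0..}" \<alpha>]) (auto simp: class_K_infinity_def)

lemma class_K_infinity_pos:
  assumes "class_K_infinity \<alpha>" "0 < s"
  shows "0 < \<alpha> s"
  using assms strict_mono_onD[of "{0..}" \<alpha> 0 s] by (auto simp: class_K_infinity_def)

lemma class_K_infinity_small:
  assumes "class_K_infinity \<alpha>" "\<eta> > 0"
  shows "\<exists>c>0. \<alpha> c < \<eta>"
proof -
  have "continuous_on {0..} \<alpha>" "\<alpha> 0 = 0" using assms by (auto simp: class_K_infinity_def)
  then obtain d where "d > 0" "\<forall>s\<in>{0..}. dist s 0 < d \<longrightarrow> dist (\<alpha> s) 0 < \<eta>"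
    using \<open>\<eta> > 0\<close> unfolding continuous_on_iff by (metis atLeast_iff order_refl)
  then have "\<bar>\<alpha> (d / 2)\<bar> < \<eta>" by (simp add: dist_real_def)
  then show ?thesis using \<open>d > 0\<close> by (intro exI[of _ "d / 2"]) simp
qed

lemma control_lyapunov_function_imp_strict_rate:
  assumes "closed A" "A \<noteq> {}" and clf: "control_lyapunov_function U A C f D g V"
  shows "\<exists>\<alpha>3. strict_clf_rate U A C f D g V \<alpha>3"
proof -
  obtain \<alpha>1 \<alpha>2 \<alpha>3 where clf: "clf_with U A C f D g V \<alpha>1 \<alpha>2 \<alpha>3"
    using clf unfolding control_lyapunov_function_def by blast
  then have pd: "positive_definite_fun \<alpha>3" by (simp add: clf_with_def)
  have nonneg: "\<alpha>3 (infdist x A) \<ge> 0" for x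
    using pd infdist_nonneg[of x A] unfolding positive_definite_fun_def by (metis less_eq_real_def)
  have half: "- \<alpha>3 (infdist x A) \<le> - (\<alpha>3 (infdist x A) / 2)" for x
    using nonneg[of x] by simp
  have "positive_definite_fun (\<lambda>s. \<alpha>3 s / 2)"
    using pd by (auto simp: positive_definite_fun_def intro!: continuous_intros)
  with clf have "clf_with U A C f D g V \<alpha>1 \<alpha>2 (\<lambda>s. \<alpha>3 s / 2)"
    unfolding clf_with_def using order_trans[OF _ half] by meson
  moreover have "(INF u\<in>Psi_d D x. V (g (x, u))) - V x < - (\<alpha>3 (infdist x A) / 2)"
    if "x \<in> jump_proj U D - A" for x
  proof -
    have "infdist x A > 0"
      using that assms(1,2) infdist_pos_not_in_closed by blast
    then have "\<alpha>3 (infdist x A) > 0" using pd by (simp add: positive_definite_fun_def)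
    moreover have "(INF u\<in>Psi_d D x. V (g (x, u))) - V x \<le> - \<alpha>3 (infdist x A)"
      using clf that by (simp add: clf_with_def)
    ultimately show ?thesis by simp
  qed
  ultimately show ?thesis unfolding strict_clf_rate_def by blast
qed

text \<open>
  The hypotheses that the stability arguments use; the conditions on \<open>Psi_d D\<close> and convexity, which
  only concern the choice of inputs, are added in a second locale.
\<close>

locale strict_clf_system =
  fixes U :: "'b::euclidean_space set" and A C :: "'a::euclidean_space set" and f :: "'a \<Rightarrow> 'a"
    and D :: "('a \<times> 'b) set" and g :: "'a \<times> 'b \<Rightarrow> 'a" and V :: "'a \<Rightarrow> real" and \<alpha>3 :: "real \<Rightarrow> real"
  assumes A: "compact A" "A \<noteq> {}"
    and basic: "hybrid_basic_conditions U C f D g"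
    and rate: "strict_clf_rate U A C f D g V \<alpha>3"
begin

text \<open>
  Every value of a solution of a closed loop lies in this set, and it is the set on which \<open>V\<close> is
  comparable with the distance to \<open>A\<close>.
\<close>

definition X where "X = C \<union> jump_proj U D \<union> g ` D"

text \<open>
  The real-valued expression that \<open>Gamma_d\<close> takes on \<open>D\<close>, defined for all pairs so that continuity can
  be used without reference to \<open>D\<close>. An input is admissible when its excess is nonpositive.
\<close>

definition excess where "excess = (\<lambda>(x, u). V (g (x, u)) - V x + \<alpha>3 (infdist x A))"

lemma jump_proj_eq: "jump_proj U D = {x. Psi_d D x \<noteq> {}}"
  using basic by (auto simp: jump_proj_def Psi_d_def hybrid_basic_conditions_def)

lemma V_between:
  obtains \<alpha>1 \<alpha>2 where "class_K_infinity \<alpha>1" "class_K_infinity \<alpha>2"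
    "\<And>x. x \<in> X \<Longrightarrow> \<alpha>1 (infdist x A) \<le> V x" "\<And>x. x \<in> X \<Longrightarrow> V x \<le> \<alpha>2 (infdist x A)"
proof -
  obtain \<alpha>1 \<alpha>2 where "clf_with U A C f D g V \<alpha>1 \<alpha>2 \<alpha>3"
    using rate unfolding strict_clf_rate_def by blast
  then have "class_K_infinity \<alpha>1" "class_K_infinity \<alpha>2"
    "\<forall>x\<in>X. \<alpha>1 (infdist x A) \<le> V x \<and> V x \<le> \<alpha>2 (infdist x A)"
    unfolding clf_with_def X_def by simp_all
  then show thesis by (intro that[of \<alpha>1 \<alpha>2]) auto
qed

lemma V_continuous: "continuous_on UNIV V"
  using rate unfolding strict_clf_rate_def clf_with_def by blast

lemma \<alpha>3_pd: "positive_definite_fun \<alpha>3"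
  using rate unfolding strict_clf_rate_def clf_with_def by blast

lemma \<alpha>3_nonneg: "\<alpha>3 (infdist x A) \<ge> 0"
  using \<alpha>3_pd infdist_nonneg[of x A] unfolding positive_definite_fun_def by (metis less_eq_real_def)

lemma V_nonneg:
  assumes x: "x \<in> X"
  shows "V x \<ge> 0"
proof -
  obtain \<alpha>1 \<alpha>2 where *: "class_K_infinity \<alpha>1" "class_K_infinity \<alpha>2"
    "\<And>x. x \<in> X \<Longrightarrow> \<alpha>1 (infdist x A) \<le> V x" "\<And>x. x \<in> X \<Longrightarrow> V x \<le> \<alpha>2 (infdist x A)"
    using V_between by metis
  have "\<alpha>1 0 = 0" using *(1) by (simp add: class_K_infinity_def)
  then show ?thesis
    using class_K_infinity_mono[OF *(1) order_refl infdist_nonneg[of x A]] *(3)[OF x] by simp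
qed

lemma V_eq_0_iff:
  assumes x: "x \<in> X"
  shows "V x = 0 \<longleftrightarrow> x \<in> A"
proof -
  obtain \<alpha>1 \<alpha>2 where *: "class_K_infinity \<alpha>1" "class_K_infinity \<alpha>2"
    "\<And>x. x \<in> X \<Longrightarrow> \<alpha>1 (infdist x A) \<le> V x" "\<And>x. x \<in> X \<Longrightarrow> V x \<le> \<alpha>2 (infdist x A)"
    using V_between by metis
  have "\<alpha>2 0 = 0" using *(2) by (simp add: class_K_infinity_def)
  moreover have "infdist x A > 0" if "x \<notin> A"
    using that A compact_imp_closed infdist_pos_not_in_closed by blast
  ultimately show ?thesis
    using class_K_infinity_pos[OF *(1), of "infdist x A"] *(3,4)[OF x] V_nonneg[OF x] by fastforce
qed

lemma flow_gradient:
  obtains dV where "\<And>x. x \<in> C \<Longrightarrow> GDERIV V x :> dV x"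
    "\<And>x. x \<in> C \<Longrightarrow> dV x \<bullet> f x \<le> - \<alpha>3 (infdist x A)"
proof -
  obtain W dV where "closure C \<subseteq> W" "\<forall>x\<in>W. GDERIV V x :> dV x" "\<forall>x\<in>C. dV x \<bullet> f x \<le> - \<alpha>3 (infdist x A)"
    using rate unfolding strict_clf_rate_def clf_with_def by blast
  then show thesis using that[of dV] closure_subset by blast
qed

lemma sublevel_infdist_bounded:
  obtains s where "s > 0" "\<And>x. \<lbrakk>x \<in> X; V x \<le> M\<rbrakk> \<Longrightarrow> infdist x A \<le> s"
proof -
  obtain \<alpha>1 \<alpha>2 where *: "class_K_infinity \<alpha>1" "\<And>x. x \<in> X \<Longrightarrow> \<alpha>1 (infdist x A) \<le> V x"
    using V_between by metis
  then obtain s where s: "s \<ge> 0" "\<alpha>1 s > M" by (auto simp: class_K_infinity_def)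
  have "infdist x A \<le> s + 1" if "x \<in> X" "V x \<le> M" for x
    using class_K_infinity_less_cancel[OF *(1), of "infdist x A" s] *(2)[OF that(1)] that(2) s infdist_nonneg[of x A]
    by linarith
  then show thesis using that[of "s + 1"] s by simp
qed

lemma sublevel_bounded: "bounded {x \<in> X. V x \<le> M}"
proof -
  obtain s where s: "s > 0" "\<And>x. \<lbrakk>x \<in> X; V x \<le> M\<rbrakk> \<Longrightarrow> infdist x A \<le> s"
    using sublevel_infdist_bounded by metis
  have "bounded {x. infdist x A \<le> s}"
    using compact_infdist_le[OF A(2,1) s(1)] compact_imp_bounded by blast
  then show ?thesis by (rule bounded_subset) (use s in auto)
qed

text \<open>
  Values of \<open>V\<close> between \<open>\<eta>\<close> and \<open>M\<close> confine the distance to \<open>A\<close> to a compact interval away from \<open>0\<close>,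
  on which the continuous positive function \<open>\<alpha>3\<close> attains a positive minimum. Over all of \<open>V > \<eta>\<close> this
  would fail, since \<open>\<alpha>3\<close> may tend to \<open>0\<close> at infinity.
\<close>

lemma rate_bounded_below:
  assumes "\<eta> > 0"
  shows "\<exists>m>0. \<forall>x\<in>X. \<eta> < V x \<and> V x \<le> M \<longrightarrow> m \<le> \<alpha>3 (infdist x A)"
proof -
  obtain \<alpha>1 \<alpha>2 where *: "class_K_infinity \<alpha>2" "\<And>x. x \<in> X \<Longrightarrow> V x \<le> \<alpha>2 (infdist x A)"
    using V_between by metis
  obtain c where c: "c > 0" "\<alpha>2 c < \<eta>" using class_K_infinity_small[OF *(1) assms] by blast
  obtain s where s: "s > 0" "\<And>x. \<lbrakk>x \<in> X; V x \<le> M\<rbrakk> \<Longrightarrow> infdist x A \<le> s"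
    using sublevel_infdist_bounded by metis
  have range: "infdist x A \<in> {c..s}" if "x \<in> X" "\<eta> < V x" "V x \<le> M" for x
    using class_K_infinity_less_cancel[OF *(1), of c "infdist x A"] *(2)[OF that(1)] that c s(2)[OF that(1,3)] infdist_nonneg[of x A]
    by force
  show ?thesis
  proof (cases "{c..s} = {}")
    case True
    \<comment> \<open>No point has such a value of \<open>V\<close>, and any constant serves.\<close>
    then show ?thesis using range by (intro exI[of _ 1]) auto
  next
    case False
    have "continuous_on {c..s} \<alpha>3"
      using \<alpha>3_pd c unfolding positive_definite_fun_def by (auto intro: continuous_on_subset)
    then obtain p where p: "p \<in> {c..s}" "\<forall>q\<in>{c..s}. \<alpha>3 p \<le> \<alpha>3 q"
      using continuous_attains_inf[OF compact_Icc False] by blast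
    have "\<alpha>3 p > 0" using \<alpha>3_pd p(1) c by (auto simp: positive_definite_fun_def)
    then show ?thesis using p(2) range by blast
  qed
qed

text \<open>
  Specialises the Lyapunov theorem to a feedback for the jumps; the flow part of its hypotheses and
  the bounds on \<open>V\<close> hold for every feedback.
\<close>

theorem closed_loop_asymptotically_stable:
  assumes "0 \<le> r"
    and above: "\<And>x. \<lbrakk>(x, \<rho> x) \<in> D; V x > r\<rbrakk> \<Longrightarrow> excess (x, \<rho> x) \<le> 0"
    and below: "\<And>x. \<lbrakk>(x, \<rho> x) \<in> D; V x \<le> r\<rbrakk> \<Longrightarrow> V (g (x, \<rho> x)) \<le> r"
    and K: "closed K"
    and V_small_imp_near: "\<And>\<epsilon>. \<epsilon> > 0 \<Longrightarrow> \<exists>\<eta>>0. \<forall>x\<in>X. V x \<le> r + \<eta> \<longrightarrow> infdist x K < \<epsilon>"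
    and near_imp_V_small: "\<And>\<eta>. \<eta> > 0 \<Longrightarrow> \<exists>\<delta>>0. \<forall>k\<in>K. \<forall>x\<in>X. dist k x \<le> \<delta> \<longrightarrow> V x \<le> r + \<eta>"
  shows "renders_asymptotically_stable C f D g \<rho> K"
proof -
  obtain dV where dV: "\<And>x. x \<in> C \<Longrightarrow> GDERIV V x :> dV x"
    "\<And>x. x \<in> C \<Longrightarrow> dV x \<bullet> f x \<le> - \<alpha>3 (infdist x A)"
    using flow_gradient by metis
  show ?thesis
    unfolding renders_asymptotically_stable_def
  proof (rule lyapunov_asymptotically_stable[where X = X and V = V and dV = dV and r = r and w = "\<lambda>x. \<alpha>3 (infdist x A)"])
    show "closed C" "continuous_on UNIV f" using basic by (auto simp: hybrid_basic_conditions_def)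
    show "C \<subseteq> X" by (auto simp: X_def)
    show "{x. (x, \<rho> x) \<in> D} \<subseteq> X" by (auto simp: X_def jump_proj_eq Psi_d_def)
    show "(\<lambda>x. g (x, \<rho> x)) ` {x. (x, \<rho> x) \<in> D} \<subseteq> X" by (auto simp: X_def)
    show "V (g (x, \<rho> x)) \<le> V x - \<alpha>3 (infdist x A)" if "x \<in> {x. (x, \<rho> x) \<in> D}" "V x > r" for x
      using above[of x] that by (simp add: excess_def)
    show "V (g (x, \<rho> x)) \<le> r" if "x \<in> {x. (x, \<rho> x) \<in> D}" "V x \<le> r" for x
      using below[of x] that by simp
    show "\<exists>m>0. \<forall>x\<in>X. r + \<eta> < V x \<and> V x \<le> M \<longrightarrow> m \<le> \<alpha>3 (infdist x A)" if "\<eta> > 0" for \<eta> M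
      using rate_bounded_below[of "r + \<eta>" M] that \<open>0 \<le> r\<close> by simp
  qed (use dV V_continuous \<alpha>3_nonneg sublevel_bounded K V_small_imp_near near_imp_V_small in auto)
qed

text \<open>
  If the claim failed for every \<open>\<eta>\<close>, points at distance at least \<open>\<epsilon>\<close> from the sublevel set would have
  values of \<open>V\<close> tending to \<open>r\<close>. They lie in the compact set \<open>S\<close> below, on which the minimum of \<open>V\<close>
  exceeds \<open>r\<close>.
\<close>

lemma sublevel_near:
  assumes "compact {x. V x \<le> r}" "\<epsilon> > 0"
  shows "\<exists>\<eta>>0. \<forall>x\<in>X. V x \<le> r + \<eta> \<longrightarrow> infdist x {x. V x \<le> r} < \<epsilon>"
proof -
  define K where "K = {x. V x \<le> r}"
  obtain s where s: "s > 0" "\<And>x. \<lbrakk>x \<in> X; V x \<le> r + 1\<rbrakk> \<Longrightarrow> infdist x A \<le> s"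
    using sublevel_infdist_bounded by metis
  define S where "S = {x. infdist x A \<le> s} \<inter> {x. \<epsilon> \<le> infdist x K}"
  have "closed {x. \<epsilon> \<le> infdist x K}"
    by (intro closed_Collect_le continuous_intros)
  then have "compact S"
    unfolding S_def using compact_infdist_le[OF A(2,1) s(1)] by blast
  show ?thesis
  proof (cases "S = {}")
    case True
    then show ?thesis
      using s(2) unfolding S_def K_def by (intro exI[of _ 1]) force
  next
    case False
    then obtain p where p: "p \<in> S" "\<forall>q\<in>S. V p \<le> V q"
      using continuous_attains_inf[OF \<open>compact S\<close>] V_continuous continuous_on_subset by blast
    have "p \<notin> K" using p(1) \<open>\<epsilon> > 0\<close> by (auto simp: S_def)
    then have Vp: "V p > r" by (simp add: K_def)
    show ?thesis
    proof (intro exI conjI ballI impI)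
      show "min 1 ((V p - r) / 2) > 0" using Vp by simp
      fix x assume x: "x \<in> X" "V x \<le> r + min 1 ((V p - r) / 2)"
      then have "V x < V p" "V x \<le> r + 1" using Vp by (auto simp: min_def field_simps split: if_splits)
      then have "x \<notin> S" "infdist x A \<le> s" using p(2) s(2) x by fastforce+
      then show "infdist x {x. V x \<le> r} < \<epsilon>" by (simp add: S_def K_def)
    qed
  qed
qed

lemma near_sublevel:
  assumes "compact {x. V x \<le> r}" "\<eta> > 0"
  shows "\<exists>\<delta>>0. \<forall>k\<in>{x. V x \<le> r}. \<forall>x. dist k x \<le> \<delta> \<longrightarrow> V x \<le> r + \<eta>"
proof -
  have "open {x. V x < r + \<eta>}"
    using V_continuous by (intro open_Collect_less continuous_intros)
  then obtain \<delta> where "\<delta> > 0" "(\<Union>k\<in>{x. V x \<le> r}. cball k \<delta>) \<subseteq> {x. V x < r + \<eta>}"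
    using compact_subset_open_imp_cball_epsilon_subset[OF assms(1), of "{x. V x < r + \<eta>}"] \<open>\<eta> > 0\<close> by force
  then show ?thesis by (intro exI[of _ \<delta>]) (force simp: subset_iff)
qed

lemma closed_Psi_d: "closed (Psi_d D x)"
proof -
  have "Psi_d D x = Pair x -` D" by (auto simp: Psi_d_def)
  then show ?thesis
    using basic by (auto simp: hybrid_basic_conditions_def intro!: closed_vimage continuous_intros)
qed

lemma excess_continuous: "continuous_on UNIV excess"
proof -
  have "continuous_on UNIV g" using basic by (simp add: hybrid_basic_conditions_def)
  have g: "continuous_on UNIV (\<lambda>z. V (g z))"
    by (rule continuous_on_compose2[OF V_continuous \<open>continuous_on UNIV g\<close>]) auto
  have V: "continuous_on UNIV (\<lambda>z::'a\<times>'b. V (fst z))"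
    by (rule continuous_on_compose2[OF V_continuous]) (auto intro: continuous_intros)
  have "continuous_on UNIV (\<lambda>z::'a\<times>'b. \<alpha>3 (infdist (fst z) A))"
    by (rule continuous_on_compose2[of "{0..}" \<alpha>3])
      (use \<alpha>3_pd in \<open>auto simp: positive_definite_fun_def infdist_nonneg intro!: continuous_intros\<close>)
  then have "continuous_on UNIV (\<lambda>z. V (g z) - V (fst z) + \<alpha>3 (infdist (fst z) A))"
    using g V by (intro continuous_intros)
  then show ?thesis by (simp add: excess_def case_prod_unfold)
qed

lemma T_d_eq: "T_d U A D g V \<alpha>3 x = {u \<in> Psi_d D x. excess (x, u) \<le> 0}"
  using basic by (auto simp: T_d_def Psi_d_def Gamma_d_def superlevel_def excess_def
      hybrid_basic_conditions_def zero_ereal_def)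

lemma closed_T_d: "closed (T_d U A D g V \<alpha>3 x)"
proof -
  have "continuous_on UNIV (\<lambda>u. excess (x, u))"
    by (intro continuous_on_compose2[OF excess_continuous] continuous_intros) auto
  then have "closed {u. excess (x, u) \<le> 0}"
    by (intro closed_Collect_le continuous_intros)
  then show ?thesis
    unfolding T_d_eq using closed_Psi_d[of x] by (simp add: Collect_conj_eq closed_Int)
qed

lemma closed_graph_T_d: "closed (set_graph (T_d U A D g V \<alpha>3))"
proof -
  have "closed D" using basic by (simp add: hybrid_basic_conditions_def)
  moreover have "closed {z. excess z \<le> 0}"
    using excess_continuous by (intro closed_Collect_le continuous_intros)
  moreover have "set_graph (T_d U A D g V \<alpha>3) = D \<inter> {z. excess z \<le> 0}"
    by (auto simp: set_graph_def T_d_eq Psi_d_def)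
  ultimately show ?thesis by (simp add: closed_Int)
qed

text \<open>
  Positivity of \<open>V\<close> places \<open>x\<close> outside \<open>A\<close>, where the jump inequality is strict. The infimum need not be
  attained, so without strictness there might be no admissible input at all.
\<close>

lemma strictly_decreasing_input:
  assumes "x \<in> jump_proj U D" "V x > 0"
  shows "\<exists>u\<in>Psi_d D x. excess (x, u) < 0"
proof -
  have "x \<in> X" using assms by (simp add: X_def)
  then have "x \<notin> A" using V_eq_0_iff assms(2) by fastforce
  then have "(INF u\<in>Psi_d D x. V (g (x, u))) < V x - \<alpha>3 (infdist x A)"
    using rate assms(1) unfolding strict_clf_rate_def by (simp add: algebra_simps)
  moreover have "Psi_d D x \<noteq> {}" using assms(1) by (simp add: jump_proj_eq)
  ultimately obtain u where "u \<in> Psi_d D x" "V (g (x, u)) < V x - \<alpha>3 (infdist x A)"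
    using cInf_lessD[of "(\<lambda>u. V (g (x, u))) ` Psi_d D x"] by blast
  then show ?thesis by (intro bexI[of _ u]) (simp_all add: excess_def)
qed

lemma input_into_sublevel:
  assumes "x \<in> jump_proj U D" "V x < r"
  shows "\<exists>u\<in>Psi_d D x. V (g (x, u)) < r"
proof -
  have "(INF u\<in>Psi_d D x. V (g (x, u))) - V x \<le> - \<alpha>3 (infdist x A)"
    using rate assms(1) unfolding strict_clf_rate_def clf_with_def by blast
  then have "(INF u\<in>Psi_d D x. V (g (x, u))) < r"
    using \<alpha>3_nonneg[of x] assms(2) by linarith
  moreover have "Psi_d D x \<noteq> {}" using assms(1) by (simp add: jump_proj_eq)
  ultimately show ?thesis
    using cInf_lessD[of "(\<lambda>u. V (g (x, u))) ` Psi_d D x"] by blast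
qed

lemma convex_on_excess:
  assumes "ereal_convex_on (Psi_d D x) (\<lambda>u. Gamma_d A D g V \<alpha>3 x u r)" "V x \<ge> r"
  shows "convex_on (Psi_d D x) (\<lambda>u. excess (x, u))"
  unfolding convex_on_def
proof (intro conjI ballI allI impI)
  show cvx: "convex (Psi_d D x)" using assms by (simp add: ereal_convex_on_def)
  have \<Gamma>: "Gamma_d A D g V \<alpha>3 x u r = ereal (excess (x, u))" if "u \<in> Psi_d D x" for u
    using that assms(2) by (simp add: Gamma_d_def Psi_d_def superlevel_def excess_def)
  fix u v :: 'b and s t :: real
  assume uv: "u \<in> Psi_d D x" "v \<in> Psi_d D x" and st: "0 \<le> s" "0 \<le> t" "s + t = 1"
  have w: "s *\<^sub>R u + t *\<^sub>R v \<in> Psi_d D x" using cvx uv st by (rule convexD)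
  have s: "s = 1 - t" using st by simp
  have "Gamma_d A D g V \<alpha>3 x (s *\<^sub>R u + t *\<^sub>R v) r
      \<le> ereal s * Gamma_d A D g V \<alpha>3 x u r + ereal t * Gamma_d A D g V \<alpha>3 x v r"
    using assms(1) uv st unfolding ereal_convex_on_def s by auto
  then show "excess (x, s *\<^sub>R u + t *\<^sub>R v) \<le> s * excess (x, u) + t * excess (x, v)"
    by (simp add: \<Gamma> uv w)
qed

end


text \<open>
  Convexity of the values of \<open>Psi_d D\<close> on \<open>R_d\<close> enters through \<open>ereal_convex_on\<close>, which includes convexity of the
  domain.
\<close>

locale convex_strict_clf_system = strict_clf_system +
  assumes lsc_Psi_d: "lsc (Psi_d D)"
    and convex_\<Gamma>: "\<And>r x. \<lbrakk>r > 0; x \<in> jump_proj U D \<inter> superlevel V r\<rbrakk> \<Longrightarrow>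
      ereal_convex_on (Psi_d D x) (\<lambda>u. Gamma_d A D g V \<alpha>3 x u r)"
begin

lemma convex_on_excess_at_R_d:
  assumes "x \<in> R_d U D V"
  shows "convex_on (Psi_d D x) (\<lambda>u. excess (x, u))"
proof (rule convex_on_excess[OF convex_\<Gamma>])
  show "V x > 0" using assms by (simp add: R_d_def)
qed (use assms in \<open>auto simp: R_d_def superlevel_def\<close>)

lemma unique_minimal_norm_input:
  assumes x: "x \<in> R_d U D V"
  shows "\<exists>u. argmin_norm (T_d U A D g V \<alpha>3 x) = {u}"
proof (rule argmin_norm_singleton_of_closed_convex[OF closed_T_d])
  show "convex (T_d U A D g V \<alpha>3 x)"
    unfolding T_d_eq
  proof (rule convexI)
    fix u v and s t :: real
    assume uv: "u \<in> {u \<in> Psi_d D x. excess (x, u) \<le> 0}" "v \<in> {u \<in> Psi_d D x. excess (x, u) \<le> 0}"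
      and st: "0 \<le> s" "0 \<le> t" "s + t = 1"
    have "excess (x, s *\<^sub>R u + t *\<^sub>R v) \<le> s * excess (x, u) + t * excess (x, v)"
      using convex_on_excess_at_R_d[OF x] uv st by (auto simp: convex_on_def)
    also have "\<dots> \<le> 0"
      using uv st by (intro add_nonpos_nonpos mult_nonneg_nonpos) auto
    finally show "s *\<^sub>R u + t *\<^sub>R v \<in> {u \<in> Psi_d D x. excess (x, u) \<le> 0}"
      using convex_on_imp_convex[OF convex_on_excess_at_R_d[OF x]] uv st by (auto intro: convexD)
  qed
  show "T_d U A D g V \<alpha>3 x \<noteq> {}"
    using strictly_decreasing_input[of x] x by (force simp: T_d_eq R_d_def)
qed

lemma lsc_at_T_d:
  assumes x: "x \<in> R_d U D V"
  shows "lsc_at (T_d U A D g V \<alpha>3) x"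
proof -
  obtain u0 where u0: "u0 \<in> Psi_d D x" "excess (x, u0) < 0"
    using strictly_decreasing_input[of x] x by (auto simp: R_d_def)
  have "lsc_at (Psi_d D) x" using lsc_Psi_d by (simp add: lsc_def)
  then have "lsc_at (\<lambda>y. {u \<in> Psi_d D y. excess (y, u) \<le> 0}) x"
    by (rule lsc_at_cut_by_strictly_feasible_convex_constraint[where P = "Psi_d D" and F = excess and x = x, OF _ closed_Psi_d excess_continuous
          convex_on_imp_convex[OF convex_on_excess_at_R_d[OF x]] convex_on_excess_at_R_d[OF x] u0])
  then show ?thesis by (simp add: T_d_eq[abs_def])
qed

lemma continuous_minimal_norm_input:
  assumes x: "x \<in> R_d U D V" and Y: "x \<in> Y" "Y \<subseteq> jump_proj U D"
    and \<rho>: "\<And>y. y \<in> Y \<inter> {y. V y > 0} \<Longrightarrow> argmin_norm (T_d U A D g V \<alpha>3 y) = {\<rho> y}"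
  shows "continuous (at x within Y) \<rho>"
proof -
  have "open {y. V y > 0}"
    using V_continuous by (intro open_Collect_less continuous_intros)
  then have "at x within Y = at x within (Y \<inter> {y. V y > 0})"
    using x by (intro at_within_nhd[of _ "{y. V y > 0}"]) (auto simp: R_d_def)
  moreover have "continuous (at x within (Y \<inter> {y. V y > 0})) \<rho>"
    using x Y by (intro continuous_minimal_norm_selection[OF lsc_at_T_d[OF x] closed_graph_T_d] \<rho>)
      (auto simp: R_d_def)
  ultimately show ?thesis by (simp add: continuous_within)
qed

text \<open>
  Above the level \<open>r\<close> the feedback is the minimal-norm element of \<open>T_d\<close>. Below it, where \<open>T_d\<close> may be
  empty (on \<open>A\<close> the infimum need not be attained), it is any input sending \<open>x\<close> below \<open>r\<close>.
\<close>

theorem practical_stabilization: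
  assumes "r > 0" and K: "compact {x. V x \<le> r}"
  shows "\<exists>\<rho>. (\<forall>x \<in> jump_proj U D. \<rho> x \<in> U) \<and>
     (\<forall>x \<in> R_d U D V \<inter> superlevel V r. argmin_norm (T_d U A D g V \<alpha>3 x) = {\<rho> x}) \<and>
     renders_asymptotically_stable C f D g \<rho> {x. V x \<le> r} \<and>
     continuous_on (jump_proj U D \<inter> superlevel V r) \<rho>"
proof -
  \<comment> \<open>Pointwise choice of an input for both regimes; outside the jump set its value is
    arbitrary.\<close>
  have "\<exists>u. x \<in> jump_proj U D \<longrightarrow> u \<in> Psi_d D x \<and>
      (if r \<le> V x then argmin_norm (T_d U A D g V \<alpha>3 x) = {u} else V (g (x, u)) < r)" for x
  proof (cases "x \<in> jump_proj U D")
    case x: True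
    show ?thesis
    proof (cases "r \<le> V x")
      case True
      then obtain u where u: "argmin_norm (T_d U A D g V \<alpha>3 x) = {u}"
        using unique_minimal_norm_input[of x] x \<open>r > 0\<close> by (auto simp: R_d_def)
      then have "u \<in> T_d U A D g V \<alpha>3 x" by (metis argmin_norm_iff singletonI)
      then show ?thesis using u True by (auto simp: T_d_eq)
    next
      case False
      then show ?thesis using input_into_sublevel[OF x, of r] by auto
    qed
  qed simp
  then obtain \<rho> where \<rho>: "\<And>x. x \<in> jump_proj U D \<Longrightarrow> \<rho> x \<in> Psi_d D x"
    and \<rho>_min: "\<And>x. \<lbrakk>x \<in> jump_proj U D; r \<le> V x\<rbrakk> \<Longrightarrow> argmin_norm (T_d U A D g V \<alpha>3 x) = {\<rho> x}"
    and \<rho>_low: "\<And>x. \<lbrakk>x \<in> jump_proj U D; V x < r\<rbrakk> \<Longrightarrow> V (g (x, \<rho> x)) < r"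
    by (metis linorder_not_le)
  have decrease: "excess (x, \<rho> x) \<le> 0" if "x \<in> jump_proj U D" "r \<le> V x" for x
  proof -
    have "\<rho> x \<in> T_d U A D g V \<alpha>3 x"
      using \<rho>_min[OF that] by (metis argmin_norm_iff singletonI)
    then show ?thesis by (simp add: T_d_eq)
  qed
  have dom: "x \<in> jump_proj U D" if "(x, \<rho> x) \<in> D" for x
    using that by (auto simp: jump_proj_eq Psi_d_def)
  show ?thesis
  proof (intro exI[of _ \<rho>] conjI ballI)
    show "\<rho> x \<in> U" if "x \<in> jump_proj U D" for x
      using \<rho>[OF that] basic by (auto simp: Psi_d_def hybrid_basic_conditions_def)
    show "argmin_norm (T_d U A D g V \<alpha>3 x) = {\<rho> x}" if "x \<in> R_d U D V \<inter> superlevel V r" for x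
      using that by (intro \<rho>_min) (auto simp: R_d_def superlevel_def)
    show "renders_asymptotically_stable C f D g \<rho> {x. V x \<le> r}"
    proof (rule closed_loop_asymptotically_stable[where r = r])
      show "V (g (x, \<rho> x)) \<le> r" if "(x, \<rho> x) \<in> D" "V x \<le> r" for x
      proof (cases "V x = r")
        case True
        then show ?thesis using decrease[OF dom[OF that(1)]] \<alpha>3_nonneg[of x] by (simp add: excess_def)
      next
        case False
        then show ?thesis using \<rho>_low[OF dom[OF that(1)]] that(2) by simp
      qed
      show "\<exists>\<delta>>0. \<forall>k\<in>{x. V x \<le> r}. \<forall>x\<in>X. dist k x \<le> \<delta> \<longrightarrow> V x \<le> r + \<eta>" if "\<eta> > 0" for \<eta>
        using near_sublevel[OF K that] by blast
    qed (use decrease dom \<open>r > 0\<close> compact_imp_closed[OF K] sublevel_near[OF K] in auto)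
    show "continuous_on (jump_proj U D \<inter> superlevel V r) \<rho>"
      unfolding continuous_on_eq_continuous_within
    proof
      fix x assume "x \<in> jump_proj U D \<inter> superlevel V r"
      then show "continuous (at x within jump_proj U D \<inter> superlevel V r) \<rho>"
        using \<open>r > 0\<close> by (intro continuous_minimal_norm_input \<rho>_min) (auto simp: R_d_def superlevel_def)
    qed
  qed
qed

text \<open>
  With level \<open>r = 0\<close> the target is \<open>A\<close> itself. The values of \<open>T'\<close> coincide with those of \<open>T_d\<close>
  where \<open>V > 0\<close> and are \<open>{0}\<close> where \<open>V = 0\<close>, so that jumps from \<open>A\<close> are those of the zero feedback. At the interface continuity needs a separate
  argument: the graph of \<open>T'\<close> need not be closed there, but the minimal norms tend to \<open>0\<close>.
\<close>

theorem global_stabilization: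
  assumes zero: "\<And>x. x \<in> jump_proj U D \<inter> A \<Longrightarrow> (x, 0) \<in> D"
    and A_invariant: "\<And>E \<phi> j. \<lbrakk>maximal_hybrid_solution {} f (jump_proj U D \<inter> A) (\<lambda>x. g (x, 0)) E \<phi>; (0, j) \<in> E\<rbrakk>
       \<Longrightarrow> infdist (\<phi> 0 j) A = 0"
    and lsc_T': "\<And>x. x \<in> jump_proj U D \<inter> superlevel V 0 \<Longrightarrow> lsc_at (T_prime_d U A D g V \<alpha>3 (\<lambda>_. 0)) x"
  shows "\<exists>\<rho>. (\<forall>x \<in> jump_proj U D. \<rho> x \<in> U \<and> argmin_norm (T_prime_d U A D g V \<alpha>3 (\<lambda>_. 0) x) = {\<rho> x}) \<and>
     renders_asymptotically_stable C f D g \<rho> A \<and> continuous_on (jump_proj U D) \<rho>"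
proof -
  let ?T' = "T_prime_d U A D g V \<alpha>3 (\<lambda>_. 0)"
  have T'_pos: "?T' x = T_d U A D g V \<alpha>3 x" if "x \<in> R_d U D V" for x
    using that by (auto simp: T_prime_d_def S_prime_d_def S_circ_d_def T_d_def R_d_def superlevel_def)
  have V0: "x \<in> A" if "x \<in> jump_proj U D" "\<not> V x > 0" for x
    using V_eq_0_iff[of x] V_nonneg[of x] that by (auto simp: X_def)
  have T'_zero: "?T' x = {0}" if "x \<in> jump_proj U D" "\<not> V x > 0" for x
    using zero[of x] V0 that by (auto simp: T_prime_d_def S_prime_d_def Psi_d_def)
  have "\<exists>u. x \<in> jump_proj U D \<longrightarrow> argmin_norm (?T' x) = {u}" for x
    using unique_minimal_norm_input[of x] T'_pos[of x] T'_zero[of x]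
    by (cases "V x > 0") (auto simp: R_d_def argmin_norm_def is_arg_min_def)
  then obtain \<rho> where \<rho>: "\<And>x. x \<in> jump_proj U D \<Longrightarrow> argmin_norm (?T' x) = {\<rho> x}"
    by metis
  then have \<rho>T': "\<rho> x \<in> ?T' x" if "x \<in> jump_proj U D" for x
    using that by (metis argmin_norm_iff singletonI)
  have dom: "x \<in> jump_proj U D" if "(x, \<rho> x) \<in> D" for x
    using that by (auto simp: jump_proj_eq Psi_d_def)
  have jump_from_A: "V (g (x, 0)) = 0" if x: "x \<in> jump_proj U D \<inter> A" for x
  proof -
    have "(0, 1) \<in> {0::real} \<times> {j::nat. \<forall>i<j. ((\<lambda>x. g (x, 0)) ^^ i) x \<in> jump_proj U D \<inter> A}"
      using x by auto
    \<comment> \<open>The first jump of the maximal discrete solution starting at \<open>x\<close>.\<close>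
    from A_invariant[OF discrete_maximal_solution[OF x] this] have "infdist (g (x, 0)) A = 0" by simp
    then have "g (x, 0) \<in> A"
      using A compact_imp_closed in_closed_iff_infdist_zero by blast
    moreover have "g (x, 0) \<in> X" using zero[OF x] by (auto simp: X_def)
    ultimately show ?thesis using V_eq_0_iff by blast
  qed
  obtain \<alpha>1 \<alpha>2 where K: "class_K_infinity \<alpha>1" "class_K_infinity \<alpha>2"
    "\<And>x. x \<in> X \<Longrightarrow> \<alpha>1 (infdist x A) \<le> V x" "\<And>x. x \<in> X \<Longrightarrow> V x \<le> \<alpha>2 (infdist x A)"
    using V_between by metis
  show ?thesis
  proof (intro exI[of _ \<rho>] conjI ballI \<rho>)
    show "\<rho> x \<in> U" if "x \<in> jump_proj U D" for x
      using \<rho>T'[OF that] basic by (auto simp: T_prime_d_def Psi_d_def hybrid_basic_conditions_def)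
    show "renders_asymptotically_stable C f D g \<rho> A"
    proof (rule closed_loop_asymptotically_stable[where r = 0])
      show "excess (x, \<rho> x) \<le> 0" if "(x, \<rho> x) \<in> D" "V x > 0" for x
        using \<rho>T'[OF dom[OF that(1)]] T'_pos[of x] that dom by (auto simp: R_d_def T_d_eq)
      show "V (g (x, \<rho> x)) \<le> 0" if "(x, \<rho> x) \<in> D" "V x \<le> 0" for x
        using \<rho>T'[OF dom[OF that(1)]] T'_zero[OF dom[OF that(1)]] V0[OF dom[OF that(1)]] that(2)
          jump_from_A[of x] dom[OF that(1)] by simp
      show "\<exists>\<eta>>0. \<forall>x\<in>X. V x \<le> 0 + \<eta> \<longrightarrow> infdist x A < \<epsilon>" if "\<epsilon> > 0" for \<epsilon>
      proof (intro exI conjI ballI impI)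
        show "\<alpha>1 \<epsilon> / 2 > 0" using class_K_infinity_pos[OF K(1) that] by simp
        then show "infdist x A < \<epsilon>" if "x \<in> X" "V x \<le> 0 + \<alpha>1 \<epsilon> / 2" for x
          using class_K_infinity_less_cancel[OF K(1), of "infdist x A" \<epsilon>] K(3)[OF that(1)] that(2) \<open>\<epsilon> > 0\<close>
          by (simp add: infdist_nonneg)
      qed
      show "\<exists>\<delta>>0. \<forall>k\<in>A. \<forall>x\<in>X. dist k x \<le> \<delta> \<longrightarrow> V x \<le> 0 + \<eta>" if \<eta>: "\<eta> > 0" for \<eta>
      proof -
        obtain c where c: "c > 0" "\<alpha>2 c < \<eta>" using class_K_infinity_small[OF K(2) \<eta>] by blast
        have "V x \<le> 0 + \<eta>" if "k \<in> A" "x \<in> X" "dist k x \<le> c" for k x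
        proof -
          have "infdist x A \<le> c" using that by (intro infdist_le2[of k]) (auto simp: dist_commute)
          then have "\<alpha>2 (infdist x A) \<le> \<alpha>2 c" by (intro class_K_infinity_mono[OF K(2)] infdist_nonneg)
          then show ?thesis using K(4)[OF that(2)] c by simp
        qed
        with c show ?thesis by blast
      qed
    qed (use A compact_imp_closed in auto)
    show "continuous_on (jump_proj U D) \<rho>"
      unfolding continuous_on_eq_continuous_within
    proof
      fix x assume x: "x \<in> jump_proj U D"
      show "continuous (at x within jump_proj U D) \<rho>"
      proof (cases "V x > 0")
        case True
        show ?thesis
        proof (rule continuous_minimal_norm_input)
          show "argmin_norm (T_d U A D g V \<alpha>3 y) = {\<rho> y}" if "y \<in> jump_proj U D \<inter> {y. V y > 0}" for y
            using that \<rho>[of y] T'_pos[of y] by (simp add: R_d_def)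
        qed (use x True in \<open>auto simp: R_d_def\<close>)
      next
        case False
        have "lsc_at ?T' x"
          using lsc_T'[of x] x V_nonneg[of x] by (simp add: superlevel_def X_def)
        show ?thesis
          unfolding continuous_within_sequentially
        proof (intro allI impI, elim conjE)
          fix \<xi> assume \<xi>: "\<forall>n::nat. \<xi> n \<in> jump_proj U D" "\<xi> \<longlonglongrightarrow> x"
          have "\<rho> x = 0" using \<rho>T'[OF x] T'_zero[OF x False] by simp
          have "0 \<in> ?T' x" using T'_zero[OF x False] by simp
          then obtain \<zeta> where \<zeta>: "\<zeta> \<longlonglongrightarrow> 0" "\<forall>\<^sub>F i in sequentially. \<zeta> i \<in> ?T' (\<xi> i)"
            using \<open>lsc_at ?T' x\<close> \<xi>(2) unfolding lsc_at_def by blast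
          have "\<forall>\<^sub>F i in sequentially. norm ((\<rho> \<circ> \<xi>) i) \<le> norm (\<zeta> i)"
            using \<zeta>(2)
          proof eventually_elim
            case (elim i)
            have "\<rho> (\<xi> i) \<in> argmin_norm (?T' (\<xi> i))" using \<rho> \<xi>(1) by simp
            then show ?case using elim by (simp add: argmin_norm_iff)
          qed
          then show "(\<rho> \<circ> \<xi>) \<longlonglongrightarrow> \<rho> x"
            unfolding \<open>\<rho> x = 0\<close> by (rule Lim_null_comparison) (use \<zeta>(1) tendsto_norm_zero in blast)
        qed
      qed
    qed
  qed
qed

end

section \<open>Stabilization by minimal-norm feedback\<close>

theorem corollary3p7:
  fixes U :: "(real ^ 'm) set"
    and A C :: "(real ^ 'n) set"
    and f :: "real ^ 'n \<Rightarrow> real ^ 'n"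
    and D :: "((real ^ 'n) \<times> (real ^ 'm)) set"
    and g :: "(real ^ 'n) \<times> (real ^ 'm) \<Rightarrow> real ^ 'n"
    and V :: "real ^ 'n \<Rightarrow> real"
  assumes "compact A" and "A \<noteq> {}"
    and "hybrid_basic_conditions U C f D g"
    and "control_lyapunov_function U A C f D g V"
    and M1d: "lsc (Psi_d D)" "\<And>x. convex (Psi_d D x)"
  shows "(\<exists>\<alpha>3. strict_clf_rate U A C f D g V \<alpha>3) \<and>
    (\<forall>\<alpha>3. strict_clf_rate U A C f D g V \<alpha>3 \<and>
       (\<forall>r>0. \<forall>x \<in> jump_proj U D \<inter> superlevel V r.
          ereal_convex_on (Psi_d D x) (\<lambda>u. Gamma_d A D g V \<alpha>3 x u r)) \<longrightarrow>
       (\<forall>r>0. compact {x. V x \<le> r} \<longrightarrow>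
          (\<exists>\<rho>'. (\<forall>x \<in> jump_proj U D. \<rho>' x \<in> U) \<and>
             (\<forall>x \<in> R_d U D V \<inter> superlevel V r. argmin_norm (T_d U A D g V \<alpha>3 x) = {\<rho>' x}) \<and>
             renders_asymptotically_stable C f D g \<rho>' {x. V x \<le> r} \<and>
             (closed (set_graph (Psi_d D)) \<longrightarrow>
                continuous_on (jump_proj U D \<inter> superlevel V r) \<rho>'))) \<and>
       (0 \<in> U \<and> (\<forall>x \<in> jump_proj U D \<inter> A. (x, 0) \<in> D) \<and>
        (\<forall>E \<phi>. maximal_hybrid_solution {} f (jump_proj U D \<inter> A) (\<lambda>x. g (x, 0)) E \<phi> \<longrightarrow>
           (\<forall>j. (0, j) \<in> E \<longrightarrow> infdist (\<phi> 0 j) A = 0)) \<and>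
        (\<forall>x \<in> jump_proj U D \<inter> superlevel V 0. lsc_at (T_prime_d U A D g V \<alpha>3 (\<lambda>_. 0)) x) \<longrightarrow>
          (\<exists>\<rho>. (\<forall>x \<in> jump_proj U D. \<rho> x \<in> U \<and>
                  argmin_norm (T_prime_d U A D g V \<alpha>3 (\<lambda>_. 0) x) = {\<rho> x}) \<and>
             renders_asymptotically_stable C f D g \<rho> A \<and>
             (closed (set_graph (Psi_d D)) \<longrightarrow> continuous_on (jump_proj U D) \<rho>))))"
proof (intro conjI allI impI; (elim conjE)?)
  show "\<exists>\<alpha>3. strict_clf_rate U A C f D g V \<alpha>3"
    using assms(1-4) by (intro control_lyapunov_function_imp_strict_rate compact_imp_closed)
next
  fix \<alpha>3 and r :: real
  assume "strict_clf_rate U A C f D g V \<alpha>3"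
    and "\<forall>r>0. \<forall>x \<in> jump_proj U D \<inter> superlevel V r.
          ereal_convex_on (Psi_d D x) (\<lambda>u. Gamma_d A D g V \<alpha>3 x u r)"
    and r: "r > 0" "compact {x. V x \<le> r}"
  then interpret convex_strict_clf_system U A C f D g V \<alpha>3
    using assms by unfold_locales auto
  show "\<exists>\<rho>'. (\<forall>x \<in> jump_proj U D. \<rho>' x \<in> U) \<and>
             (\<forall>x \<in> R_d U D V \<inter> superlevel V r. argmin_norm (T_d U A D g V \<alpha>3 x) = {\<rho>' x}) \<and>
             renders_asymptotically_stable C f D g \<rho>' {x. V x \<le> r} \<and>
             (closed (set_graph (Psi_d D)) \<longrightarrow>
                continuous_on (jump_proj U D \<inter> superlevel V r) \<rho>')"
    by (rule ex_forward[OF practical_stabilization[OF r]]) simp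
next
  fix \<alpha>3
  assume "strict_clf_rate U A C f D g V \<alpha>3"
    and "\<forall>r>0. \<forall>x \<in> jump_proj U D \<inter> superlevel V r.
          ereal_convex_on (Psi_d D x) (\<lambda>u. Gamma_d A D g V \<alpha>3 x u r)"
    and "0 \<in> U" and zero: "\<forall>x \<in> jump_proj U D \<inter> A. (x, 0) \<in> D"
      "\<forall>E \<phi>. maximal_hybrid_solution {} f (jump_proj U D \<inter> A) (\<lambda>x. g (x, 0)) E \<phi> \<longrightarrow>
           (\<forall>j. (0, j) \<in> E \<longrightarrow> infdist (\<phi> 0 j) A = 0)"
      "\<forall>x \<in> jump_proj U D \<inter> superlevel V 0. lsc_at (T_prime_d U A D g V \<alpha>3 (\<lambda>_. 0)) x"
  then interpret convex_strict_clf_system U A C f D g V \<alpha>3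
    using assms by unfold_locales auto
  show "\<exists>\<rho>. (\<forall>x \<in> jump_proj U D. \<rho> x \<in> U \<and>
                  argmin_norm (T_prime_d U A D g V \<alpha>3 (\<lambda>_. 0) x) = {\<rho> x}) \<and>
             renders_asymptotically_stable C f D g \<rho> A \<and>
             (closed (set_graph (Psi_d D)) \<longrightarrow> continuous_on (jump_proj U D) \<rho>)"
  proof (rule ex_forward[OF global_stabilization])
    show "(x, 0) \<in> D" if "x \<in> jump_proj U D \<inter> A" for x
      using zero(1) that by blast
    show "infdist (\<phi> 0 j) A = 0"
      if "maximal_hybrid_solution {} f (jump_proj U D \<inter> A) (\<lambda>x. g (x, 0)) E \<phi>" "(0, j) \<in> E" for E \<phi> j
      using zero(2) that by blast
    show "lsc_at (T_prime_d U A D g V \<alpha>3 (\<lambda>_. 0)) x" if "x \<in> jump_proj U D \<inter> superlevel V 0" for x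
      using zero(3) that by blast
  qed simp
qed

end
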